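(* Each $(\boldsymbol\omega,\mathbf{A})\in\mathcal{P}_{2,4}$ has exactly $N-1$ eigenvalues, and each $(\boldsymbol\omega,\mathbf{A})\in(\Omega_N^{\mathbb{R},+}\times\mathcal{O}_{2,4}^{\mathbb{C}})\setminus\mathcal{P}_{2,4}$ has exactly $N$ eigenvalues $\lambda_n(\boldsymbol\omega,\mathbf{A})$, $0\le n\le N-1$, which satisfy that: (i) the $\lambda_n(\boldsymbol\omega,\mathbf{A})$ are continuous in $(\Omega_N^{\mathbb{R},+}\times\mathcal{O}_{2,4}^{\mathbb{C}})\setminus\mathcal{P}_{2,4}$; (ii) the $\lambda_n(\boldsymbol\omega,\mathbf{A})$, $0\le n\le N-1$, are not continuous at each point of $\mathcal{P}_{2,4}$ and have the following asymptotic behaviors near any given $(\boldsymbol\omega_0,\mathbf{A}_0)\in\mathcal{P}_{2,4}$: $$\lim_{\mathcal{P}_{2,4}^-\cup\mathcal{P}_{2,4}\ni(\boldsymbol\omega,\mathbf{A})\to(\boldsymbol\omega_0,\mathbf{A}_0)}\lambda_n(\boldsymbol\omega,\mathbf{A})=\lambda_n(\boldsymbol\omega_0,\mathbf{A}_0),\ 0\le n\le N-2,$$ $$\lim_{\mathcal{P}_{2,4}^-\ni(\boldsymbol\omega,\mathbf{A})\to(\boldsymbol\omega_0,\mathbf{A}_0)}\lambda_{N-1}(\boldsymbol\omega,\mathbf{A})=+\infty,\qquad \lim_{\mathcal{P}_{2,4}^+\ni(\boldsymbol\omega,\mathbf{A})\to(\boldsymbol\omega_0,\mathbf{A}_0)}\lambda_0(\boldsymbol\omega,\mathbf{A})=-\infty,$$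 $$\lim_{\mathcal{P}_{2,4}^+\ni(\boldsymbol\omega,\mathbf{A})\to(\boldsymbol\omega_0,\mathbf{A}_0)}\lambda_n(\boldsymbol\omega,\mathbf{A})=\lambda_{n-1}(\boldsymbol\omega_0,\mathbf{A}_0),\ 1\le n\le N-1,$$ and consequently, $\lambda_n$ restricted in $\mathcal{P}_{2,4}^-\cup\mathcal{P}_{2,4}$ is continuous for each $0\le n\le N-2$.
   Context: Fix an integer $N\ge 2$. A self-adjoint discrete Sturm–Liouville problem is a pair $(\boldsymbol\omega,\mathbf{A})$. Here $\boldsymbol\omega=(1/f,q,w)$ with real sequences $f=\{f_n\}_{n=0}^N$, $q=\{q_n\}_{n=1}^N$, $w=\{w_n\}_{n=1}^N$, $f_n\ne0$, $w_n>0$, encodes the equation $-\nabla(f_n\Delta y_n)+q_ny_n=\lambda w_ny_n$, $1\le n\le N$, for $y=(y_0,\dots,y_{N+1})$, with $\Delta y_n=y_{n+1}-y_n$, $\nabla y_n=y_n-y_{n-1}$; the set $\Omega_N^{\mathbb{R},+}$ of all such $(1/f,q,w)$ has the topology of a subset of $\mathbb{R}^{3N+1}$. $\mathbf{A}=[A\,|\,B]$ encodes the boundary condition $A\begin{pmatrix}y_0\\ f_0\Delta y_0\end{pmatrix}+B\begin{pmatrix}y_N\\ f_N\Delta y_N\end{pmatrix}=0$, where $A,B$ are complex $2\times2$ matrices with $\mathrm{rank}(A,B)=2$ and $AJA^*=BJB^*$, $J=\begin{pmatrix}0&1\\-1&0\end{pmatrix}$; $[A\,|\,B]$ is the class of the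 $2\times4$ matrix $(A,B)$ modulo left multiplication by $GL(2,\mathbb{C})$, and $\mathcal{B}^{\mathbb{C}}$ is the set of all such classes, topologized as a subspace of the quotient of the rank-2 complex $2\times4$ matrices by $GL(2,\mathbb{C})$. $\Omega_N^{\mathbb{R},+}\times\mathcal{B}^{\mathbb{C}}$ has the product topology. An eigenvalue of $(\boldsymbol\omega,\mathbf{A})$ is a $\lambda$ for which a nonzero $y$ solves the equation and the boundary condition. Eigenvalues are real and finite in number; they are counted with multiplicity (the dimension of the solution space) and listed as $\lambda_0\le\lambda_1\le\cdots$; $\lambda_n$ is defined at a problem only if it has more than $n$ eigenvalues, and $\lambda_n$ is regarded as not continuous at a point where it is not defined. $\mathcal{O}_{2,4}^{\mathbb{C}}=\left\{\left[\begin{array}{cccc}a_{11}&-1&\bar z&0\\ z&0&b_{21}&1\end{array}\right]:a_{11},b_{21}\in\mathbb{R},\ z\in\mathbb{C}\right\}$, an open subset of $\mathcal{B}^{\mathbb{C}}$. $\mathcal{P}_{2,4}$, $\mathcal{P}_{2,4}^+$, $\mathcal{P}_{2,4}^-$ are the sets of $(\boldsymbol\omega,\mathbf{A})\in\Omega_N^{\mathbb{R},+}\times\mathcal{O}_{2,4}^{\mathbb{C}}$ with $a_{11}=-f_0$, $a_{11}>-f_0$, $a_{11}<-f_0$, respectively.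
   Formalization: In (ii), λ_n is claimed not continuous at a point of P_{2,4} except when 1≤n≤N−2 and λ_{n−1}=λ_n at that point; there the limits in (ii) make λ_n continuous (e.g. N=3, f=w=1, q=−2, a_11=z=−1, b_21=1, n=1). *)

theory Defs
  imports "HOL-Analysis.Analysis" "HOL-Library.Function_Algebras"
begin

section \<open>The space of equations\<close>

text \<open>
  An equation is the triple \<open>(1/f, q, w)\<close>; the first component stores \<open>1/f\<close>, not \<open>f\<close>.
  The sequences are extensional functions on their index sets, so that the equations form a
  subset of the product of \<open>3 * N + 1\<close> copies of the real line.
\<close>

type_synonym sl_eqn = "(nat \<Rightarrow> real) \<times> (nat \<Rightarrow> real) \<times> (nat \<Rightarrow> real)"

definition coef_f :: "sl_eqn \<Rightarrow> nat \<Rightarrow> real" where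
  "coef_f \<omega> n = 1 / fst \<omega> n"

definition coef_q :: "sl_eqn \<Rightarrow> nat \<Rightarrow> real" where
  "coef_q \<omega> = fst (snd \<omega>)"

definition coef_w :: "sl_eqn \<Rightarrow> nat \<Rightarrow> real" where
  "coef_w \<omega> = snd (snd \<omega>)"

definition eqn_space :: "nat \<Rightarrow> sl_eqn set" where
  "eqn_space N =
     {(g, q, w). g \<in> {0..N} \<rightarrow>\<^sub>E UNIV \<and> q \<in> {1..N} \<rightarrow>\<^sub>E UNIV \<and> w \<in> {1..N} \<rightarrow>\<^sub>E UNIV \<and>
        (\<forall>n\<in>{0..N}. g n \<noteq> 0) \<and> (\<forall>n\<in>{1..N}. 0 < w n)}"

definition eqn_topology :: "nat \<Rightarrow> sl_eqn topology" where
  "eqn_topology N =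
     subtopology
       (prod_topology (powertop_real {0..N})
         (prod_topology (powertop_real {1..N}) (powertop_real {1..N})))
       (eqn_space N)"


section \<open>The space of self-adjoint boundary conditions\<close>

type_synonym bc_matrix = "complex^4^2"

definition block_A :: "bc_matrix \<Rightarrow> complex^2^2" where
  "block_A M = (\<chi> i j. M $ i $ (if j = 1 then 1 else 2))"

definition block_B :: "bc_matrix \<Rightarrow> complex^2^2" where
  "block_B M = (\<chi> i j. M $ i $ (if j = 1 then 3 else 4))"

definition conj_transpose :: "complex^'n^'m \<Rightarrow> complex^'m^'n" where
  "conj_transpose M = (\<chi> i j. cnj (M $ j $ i))"

definition J_mat :: "complex^2^2" where
  "J_mat = vector [vector [0, 1], vector [- 1, 0]]"

definition rank2_matrices :: "bc_matrix set" where
  "rank2_matrices = {M. rank M = 2}"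

definition bc_class :: "bc_matrix \<Rightarrow> bc_matrix set" where
  "bc_class M = {T ** M | T :: complex^2^2. invertible T}"

text \<open>The quotient topology on the rank-2 matrices modulo left multiplication by \<open>GL(2, \<complex>)\<close>.\<close>

definition bc_quotient_topology :: "bc_matrix set topology" where
  "bc_quotient_topology =
     topology (\<lambda>U. U \<subseteq> bc_class ` rank2_matrices \<and>
       openin (top_of_set rank2_matrices) {M \<in> rank2_matrices. bc_class M \<in> U})"

lemma openin_bc_quotient_topology:
  "openin bc_quotient_topology U \<longleftrightarrow>
     U \<subseteq> bc_class ` rank2_matrices \<and>
     openin (top_of_set rank2_matrices) {M \<in> rank2_matrices. bc_class M \<in> U}"
proof -
  let ?P = "\<lambda>U. U \<subseteq> bc_class ` rank2_matrices \<and>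
       openin (top_of_set rank2_matrices) {M \<in> rank2_matrices. bc_class M \<in> U}"
  have "istopology ?P"
    unfolding istopology_def
  proof (intro conjI allI impI)
    fix S T assume "?P S" "?P T"
    moreover have "{M \<in> rank2_matrices. bc_class M \<in> S \<inter> T} =
        {M \<in> rank2_matrices. bc_class M \<in> S} \<inter> {M \<in> rank2_matrices. bc_class M \<in> T}"
      by auto
    ultimately show "S \<inter> T \<subseteq> bc_class ` rank2_matrices"
      and "openin (top_of_set rank2_matrices) {M \<in> rank2_matrices. bc_class M \<in> S \<inter> T}"
      by (auto simp only: openin_Int)
  next
    fix K assume K: "\<forall>S\<in>K. ?P S"
    have "{M \<in> rank2_matrices. bc_class M \<in> \<Union> K} =
        (\<Union>S\<in>K. {M \<in> rank2_matrices. bc_class M \<in> S})"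
      by auto
    moreover have "openin (top_of_set rank2_matrices)
        (\<Union>S\<in>K. {M \<in> rank2_matrices. bc_class M \<in> S})"
      using K by (intro openin_Union) auto
    ultimately show "openin (top_of_set rank2_matrices) {M \<in> rank2_matrices. bc_class M \<in> \<Union> K}"
      by simp
    show "\<Union> K \<subseteq> bc_class ` rank2_matrices"
      using K by blast
  qed
  then show ?thesis
    by (simp add: bc_quotient_topology_def topology_inverse')
qed

lemma topspace_bc_quotient_topology: "topspace bc_quotient_topology = bc_class ` rank2_matrices"
proof (rule antisym)
  show "topspace bc_quotient_topology \<subseteq> bc_class ` rank2_matrices"
    using openin_bc_quotient_topology openin_topspace by blast
  have "{M \<in> rank2_matrices. bc_class M \<in> bc_class ` rank2_matrices} = rank2_matrices"
    by auto
  then have "openin bc_quotient_topology (bc_class ` rank2_matrices)"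
    by (simp add: openin_bc_quotient_topology)
  then show "bc_class ` rank2_matrices \<subseteq> topspace bc_quotient_topology"
    by (rule openin_subset)
qed

lemma quotient_map_bc_class:
  "quotient_map (top_of_set rank2_matrices) bc_quotient_topology bc_class"
  by (auto simp: quotient_map_def topspace_bc_quotient_topology openin_bc_quotient_topology)

definition bc_space :: "bc_matrix set set" where
  "bc_space = bc_class ` {M \<in> rank2_matrices.
     block_A M ** J_mat ** conj_transpose (block_A M) =
     block_B M ** J_mat ** conj_transpose (block_B M)}"

definition bc_topology :: "bc_matrix set topology" where
  "bc_topology = subtopology bc_quotient_topology bc_space"


section \<open>Eigenvalues\<close>

type_synonym sl_problem = "sl_eqn \<times> bc_matrix set"

definition problem_space :: "nat \<Rightarrow> sl_problem set" where
  "problem_space N = eqn_space N \<times> bc_space"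

definition problem_topology :: "nat \<Rightarrow> sl_problem topology" where
  "problem_topology N = prod_topology (eqn_topology N) bc_topology"

definition fwd_diff :: "(nat \<Rightarrow> complex) \<Rightarrow> nat \<Rightarrow> complex" where
  "fwd_diff y n = y (n + 1) - y n"

definition bwd_diff :: "(nat \<Rightarrow> complex) \<Rightarrow> nat \<Rightarrow> complex" where
  "bwd_diff y n = y n - y (n - 1)"

definition quasi_diff :: "sl_eqn \<Rightarrow> (nat \<Rightarrow> complex) \<Rightarrow> nat \<Rightarrow> complex" where
  "quasi_diff \<omega> y n = of_real (coef_f \<omega> n) * fwd_diff y n"

definition solves_eqn :: "nat \<Rightarrow> sl_eqn \<Rightarrow> complex \<Rightarrow> (nat \<Rightarrow> complex) \<Rightarrow> bool" where
  "solves_eqn N \<omega> \<mu> y \<longleftrightarrow>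
     (\<forall>n\<in>{1..N}. - bwd_diff (quasi_diff \<omega> y) n + of_real (coef_q \<omega> n) * y n =
        \<mu> * of_real (coef_w \<omega> n) * y n)"

definition solves_bc :: "nat \<Rightarrow> sl_eqn \<Rightarrow> bc_matrix \<Rightarrow> (nat \<Rightarrow> complex) \<Rightarrow> bool" where
  "solves_bc N \<omega> M y \<longleftrightarrow>
     block_A M *v vector [y 0, quasi_diff \<omega> y 0] +
     block_B M *v vector [y N, quasi_diff \<omega> y N] = 0"

text \<open>
  Tuples \<open>(y\<^sub>0, \<dots>, y\<^sub>N\<^sub>+\<^sub>1)\<close> are sequences vanishing beyond \<open>N + 1\<close>. Whether the boundary condition
  holds does not depend on the chosen representative of the class.
\<close>

definition solution_space :: "nat \<Rightarrow> sl_problem \<Rightarrow> complex \<Rightarrow> (nat \<Rightarrow> complex) set" where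
  "solution_space N p \<mu> =
     {y. (\<forall>n > N + 1. y n = 0) \<and> solves_eqn N (fst p) \<mu> y \<and>
         (\<forall>M \<in> snd p. solves_bc N (fst p) M y)}"

definition is_eigenvalue :: "nat \<Rightarrow> sl_problem \<Rightarrow> complex \<Rightarrow> bool" where
  "is_eigenvalue N p \<mu> \<longleftrightarrow> (\<exists>y \<in> solution_space N p \<mu>. y \<noteq> 0)"

interpretation cseq: vector_space "\<lambda>(c :: complex) (y :: nat \<Rightarrow> complex) n. c * y n"
  by unfold_locales (auto simp: algebra_simps fun_eq_iff)

definition eig_mult :: "nat \<Rightarrow> sl_problem \<Rightarrow> complex \<Rightarrow> nat" where
  "eig_mult N p \<mu> = cseq.dim (solution_space N p \<mu>)"

text \<open>
  \<open>xs\<close> lists all (a priori complex) eigenvalues in nondecreasing order, each repeated according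
  to its multiplicity. In particular, a problem has such a list only if its eigenvalues are real
  and finite in number; the list is then unique.
\<close>

definition eigenvalue_list :: "nat \<Rightarrow> sl_problem \<Rightarrow> real list \<Rightarrow> bool" where
  "eigenvalue_list N p xs \<longleftrightarrow>
     sorted xs \<and> {\<mu>. is_eigenvalue N p \<mu>} = of_real ` set xs \<and>
     (\<forall>x \<in> set xs. count_list xs x = eig_mult N p (of_real x))"

definition has_exactly_eigenvalues :: "nat \<Rightarrow> sl_problem \<Rightarrow> nat \<Rightarrow> bool" where
  "has_exactly_eigenvalues N p k \<longleftrightarrow> (\<exists>xs. eigenvalue_list N p xs \<and> length xs = k)"

definition eigval :: "nat \<Rightarrow> nat \<Rightarrow> sl_problem \<Rightarrow> real" where
  "eigval N n p = (THE xs. eigenvalue_list N p xs) ! n"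

definition eigval_domain :: "nat \<Rightarrow> nat \<Rightarrow> sl_problem set" where
  "eigval_domain N n =
     {p \<in> problem_space N. \<exists>k > n. has_exactly_eigenvalues N p k}"

text \<open>
  Continuity at \<open>p\<close> of the partial function \<open>eigval N n\<close>; it fails where that function is undefined.
  The limits from the two sides of \<open>P24 N\<close> (defined below) are \<open>eigval N n p\<close> and
  \<open>eigval N (n - 1) p\<close>, so for \<open>1 \<le> n \<le> N - 2\<close> a jump occurs at \<open>p\<close> only if these differ. They agree,
  and \<open>eigval N n\<close> is continuous at \<open>p\<close>, when \<open>p\<close> has a corresponding double eigenvalue: take
  \<open>N = 3\<close>, \<open>n = 1\<close>, \<open>f = w = 1\<close>, \<open>q = - 2\<close> and the boundary matrix \<open>mat24 (- 1) (- 1) 1\<close>, where \<open>0\<close> is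
  the only eigenvalue and has multiplicity two.
\<close>

definition eigval_continuous_at :: "nat \<Rightarrow> nat \<Rightarrow> sl_problem \<Rightarrow> bool" where
  "eigval_continuous_at N n p \<longleftrightarrow>
     topcontinuous_at (subtopology (problem_topology N) (eigval_domain N n)) euclideanreal
       (eigval N n) p"


section \<open>The coordinate set and its decomposition\<close>

definition mat24 :: "real \<Rightarrow> complex \<Rightarrow> real \<Rightarrow> bc_matrix" where
  "mat24 a z b = vector [vector [of_real a, - 1, cnj z, 0], vector [z, 0, of_real b, 1]]"

definition O24 :: "bc_matrix set set" where
  "O24 = {bc_class (mat24 a z b) | a z b. True}"

definition P24 :: "nat \<Rightarrow> sl_problem set" where
  "P24 N = {(\<omega>, bc_class (mat24 a z b)) | \<omega> a z b. \<omega> \<in> eqn_space N \<and> a = - coef_f \<omega> 0}"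

definition P24_plus :: "nat \<Rightarrow> sl_problem set" where
  "P24_plus N = {(\<omega>, bc_class (mat24 a z b)) | \<omega> a z b. \<omega> \<in> eqn_space N \<and> a > - coef_f \<omega> 0}"

definition P24_minus :: "nat \<Rightarrow> sl_problem set" where
  "P24_minus N = {(\<omega>, bc_class (mat24 a z b)) | \<omega> a z b. \<omega> \<in> eqn_space N \<and> a < - coef_f \<omega> 0}"

end

theory Submission
  imports Defs
begin

text \<open>
  Summation by parts turns a problem with boundary matrix \<open>mat24 a z b\<close> into a Hermitian pencil
  \<open>Q y v = \<mu> * W y v\<close> in the coordinates \<open>0, \<dots>, N\<close>, where \<open>W\<close> is positive semidefinite and its kernel is
  spanned by the coordinate \<open>0\<close>, on which \<open>Q\<close> takes the value \<open>c = a + f\<^sub>0\<close>. If \<open>c \<noteq> 0\<close>, that coordinate is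
  eliminated by a Schur complement and \<open>N\<close> eigenvalues remain; if \<open>c = 0\<close>, it acts as a Lagrange
  multiplier and \<open>N - 1\<close> remain. In all cases the negative index of \<open>Q - \<alpha> W\<close> is the number of
  eigenvalues below \<open>\<alpha>\<close>, plus one if \<open>c \<le> 0\<close> (for \<open>c = 0\<close> the coordinate \<open>0\<close> lies in a hyperbolic plane);
  dually, the positive index is the number of eigenvalues above \<open>\<alpha>\<close>, plus one if \<open>c \<ge> 0\<close>. Both
  indices are lower semicontinuous in the problem, and all limits follow by counting.
\<close>

section \<open>Hermitian forms on sequences\<close>

text \<open>The obstacle is that no reduced matrix depends continuously on the problem across
  \<open>P24\<close>: the Schur complement contains \<open>1 / c\<close>, which blows up as
  \<open>c\<close> tends to 0, and the number of eigenvalues changes there. The unreduced form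
  \<open>Q - \<alpha> W\<close> on all \<open>N + 1\<close> coordinates is continuous throughout.
  The reduction therefore serves only at a single problem, to relate eigenvalues to indices, and
  different problems are compared through indices alone. These are lower semicontinuous because a
  family on which the form is negative definite stays so under small changes of the form. Indices
  may drop in the limit, so the negative index yields only upper estimates of eigenvalues and the
  positive index supplies the lower ones. Both estimates meet because the number of eigenvalues plus
  the two corrections for coordinate \<open>0\<close> is always \<open>N + 1\<close>. The divergence
  has the same source: when \<open>c\<close> leaves 0 upwards, coordinate \<open>0\<close> drops out
  of the negative index, and an eigenvalue near minus infinity has to replace it; when
  \<open>c\<close> leaves 0 downwards, one near plus infinity has to replace it in the positive
  index.\<close>

lemma homogeneous_solution:
  fixes A :: "nat \<Rightarrow> 'i \<Rightarrow> 'a::field"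
  assumes "finite I" "n < card I"
  shows "\<exists>x. (\<exists>i\<in>I. x i \<noteq> 0) \<and> (\<forall>k<n. (\<Sum>i\<in>I. A k i * x i) = 0)"
  using assms
proof (induction n arbitrary: I A)
  case 0
  then have "I \<noteq> {}" by auto
  then show ?case by (intro exI[of _ "\<lambda>_. 1"]) auto
next
  case (Suc n)
  show ?case
  proof (cases "\<forall>i\<in>I. A n i = 0")
    case True
    obtain x where x: "\<exists>i\<in>I. x i \<noteq> 0" "\<forall>k<n. (\<Sum>i\<in>I. A k i * x i) = 0"
      using Suc.IH[of I A] Suc.prems by auto
    have "(\<Sum>i\<in>I. A k i * x i) = 0" if "k < Suc n" for k
      using x(2) True that by (cases "k = n") auto
    then show ?thesis using x(1) by blast
  next
    case False
    \<comment> \<open>Gaussian elimination: the last equation is solved for the unknown at the pivot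
      \<open>p\<close>, and the remaining \<open>n\<close> equations involve one unknown
      fewer.\<close>
    then obtain p where p: "p \<in> I" "A n p \<noteq> 0" by auto
    let ?I = "I - {p}"
    have "finite ?I" "n < card ?I" using Suc.prems p(1) by auto
    then obtain x where x: "\<exists>i\<in>?I. x i \<noteq> 0"
      "\<forall>k<n. (\<Sum>i\<in>?I. (A k i - A n i / A n p * A k p) * x i) = 0"
      using Suc.IH[of ?I "\<lambda>k i. A k i - A n i / A n p * A k p"] by blast
    define s where "s = (\<Sum>i\<in>?I. A n i * x i)"
    define y where "y = (\<lambda>i. if i = p then - s / A n p else x i)"
    have sum_y: "(\<Sum>i\<in>I. A k i * y i) = (\<Sum>i\<in>?I. A k i * x i) - A k p / A n p * s" for k
    proof -
      have "(\<Sum>i\<in>I. A k i * y i) = A k p * y p + (\<Sum>i\<in>?I. A k i * y i)"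
        using Suc.prems(1) p(1) by (rule sum.remove)
      also have "(\<Sum>i\<in>?I. A k i * y i) = (\<Sum>i\<in>?I. A k i * x i)"
        by (intro sum.cong) (auto simp: y_def)
      finally show ?thesis by (simp add: y_def)
    qed
    have "(\<Sum>i\<in>I. A k i * y i) = 0" if "k < Suc n" for k
    proof (cases "k = n")
      case True
      then show ?thesis using p by (simp add: sum_y s_def)
    next
      case False
      have "(\<Sum>i\<in>?I. (A k i - A n i / A n p * A k p) * x i) =
          (\<Sum>i\<in>?I. A k i * x i) - A k p / A n p * s"
        by (simp add: s_def sum_distrib_left sum_subtractf algebra_simps)
      then show ?thesis using x(2) False that by (simp add: sum_y)
    qed
    moreover have "\<exists>i\<in>I. y i \<noteq> 0" using x(1) by (auto simp: y_def)
    ultimately show ?thesis by blast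
  qed
qed

text \<open>An indexed family rather than a set of vectors: vectors may repeat, and the index set
  may be a tagged union of two families.\<close>

definition lincomb :: "'i set \<Rightarrow> ('i \<Rightarrow> complex) \<Rightarrow> ('i \<Rightarrow> nat \<Rightarrow> complex) \<Rightarrow> nat \<Rightarrow> complex" where
  "lincomb I x b = (\<lambda>n. \<Sum>i\<in>I. x i * b i n)"

definition unit_seq :: "nat \<Rightarrow> nat \<Rightarrow> complex" where
  "unit_seq k = (\<lambda>n. if n = k then 1 else 0)"

lemma lincomb_dependent:
  assumes "finite I" "N + 1 < card I"
  shows "\<exists>x. (\<exists>i\<in>I. x i \<noteq> 0) \<and> (\<forall>n\<le>N. lincomb I x b n = 0)"
  using homogeneous_solution[OF assms, of "\<lambda>n i. b i n"]
  by (auto simp: lincomb_def less_Suc_eq_le mult.commute)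

text \<open>The unit sequences at \<open>0, \<dots>, N\<close> are themselves combinations of the
  family. With fewer than \<open>N + 1\<close> members, some nonzero \<open>c\<close> annihilates
  the matrix of their coefficients, and this \<open>c\<close> would be a linear relation between the
  unit sequences.\<close>

lemma lincomb_spanning:
  fixes b :: "'i \<Rightarrow> nat \<Rightarrow> complex"
  assumes "finite I" and span: "\<And>y. \<exists>x. \<forall>n\<le>N. y n = lincomb I x b n"
  shows "N + 1 \<le> card I"
proof (rule ccontr)
  assume "\<not> N + 1 \<le> card I"
  then have less: "card I < card {..N}" by simp
  obtain g where g: "bij_betw g {..<card I} I"
    using ex_bij_betw_nat_finite[OF \<open>finite I\<close>] by (auto simp: atLeast0LessThan)
  have "\<forall>k. \<exists>x. \<forall>n\<le>N. unit_seq k n = lincomb I x b n"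
    using span by blast
  from choice[OF this] obtain x
    where x: "\<And>k n. n \<le> N \<Longrightarrow> unit_seq k n = lincomb I (x k) b n"
    by blast
  obtain c where c: "\<exists>k\<in>{..N}. c k \<noteq> 0" "\<forall>j<card I. (\<Sum>k\<in>{..N}. x k (g j) * c k) = 0"
    using homogeneous_solution[OF _ less, of "\<lambda>j k. x k (g j)"] by auto
  have c0: "(\<Sum>k\<in>{..N}. x k i * c k) = 0" if "i \<in> I" for i
  proof -
    have "i \<in> g ` {..<card I}"
      using that bij_betw_imp_surj_on[OF g] by simp
    then obtain j where "j < card I" "i = g j" by auto
    then show ?thesis using c(2) by auto
  qed
  have "c n = 0" if "n \<le> N" for n
  proof -
    have "c n = (\<Sum>k\<in>{..N}. c k * unit_seq k n)"
      using that by (simp add: unit_seq_def if_distrib cong: if_cong)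
    also have "\<dots> = (\<Sum>k\<in>{..N}. \<Sum>i\<in>I. c k * (x k i * b i n))"
      using that by (simp add: x lincomb_def sum_distrib_left)
    also have "\<dots> = (\<Sum>i\<in>I. (\<Sum>k\<in>{..N}. x k i * c k) * b i n)"
      by (subst sum.swap) (simp add: sum_distrib_left mult_ac)
    also have "\<dots> = 0" using c0 by simp
    finally show ?thesis .
  qed
  then show False using c(1) by auto
qed

definition hermitian_form :: "((nat \<Rightarrow> complex) \<Rightarrow> (nat \<Rightarrow> complex) \<Rightarrow> complex) \<Rightarrow> bool" where
  "hermitian_form h \<longleftrightarrow>
     (\<forall>u v w. h (\<lambda>n. u n + v n) w = h u w + h v w) \<and>
     (\<forall>c u w. h (\<lambda>n. c * u n) w = c * h u w) \<and>
     (\<forall>u v. h v u = cnj (h u v))"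

context
  fixes h assumes h: "hermitian_form h"
begin

lemma herm_sym: "h v u = cnj (h u v)"
  using h unfolding hermitian_form_def by blast

lemma herm_add: "h (\<lambda>n. u n + v n) w = h u w + h v w"
  using h unfolding hermitian_form_def by blast

lemma herm_scale: "h (\<lambda>n. c * u n) w = c * h u w"
  using h unfolding hermitian_form_def by blast

lemma herm_add_right: "h w (\<lambda>n. u n + v n) = h w u + h w v"
  by (metis herm_sym herm_add complex_cnj_add)

lemma herm_scale_right: "h w (\<lambda>n. c * u n) = cnj c * h w u"
  by (metis herm_sym herm_scale complex_cnj_mult)

lemma herm_zero: "h (\<lambda>n. 0) w = 0"
  using herm_scale[of 0 "\<lambda>_. 0" w] by simp

lemma herm_diff: "h (\<lambda>n. u n - v n) w = h u w - h v w"
  using herm_add[of u "\<lambda>n. (-1) * v n" w] herm_scale[of "-1" v w] by simp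

lemma herm_diff_right: "h w (\<lambda>n. u n - v n) = h w u - h w v"
  by (metis herm_sym herm_diff complex_cnj_diff)

lemma herm_lincomb: "finite I \<Longrightarrow> h (lincomb I x b) w = (\<Sum>i\<in>I. x i * h (b i) w)"
proof (induction rule: finite_induct)
  case empty
  then show ?case using herm_zero by (simp add: lincomb_def)
next
  case (insert i I)
  have "lincomb (insert i I) x b = (\<lambda>n. x i * b i n + lincomb I x b n)"
    using insert by (auto simp: lincomb_def)
  then show ?case using insert by (simp add: herm_add herm_scale)
qed

lemma herm_lincomb_right: "finite I \<Longrightarrow> h w (lincomb I x b) = (\<Sum>i\<in>I. cnj (x i) * h w (b i))"
proof -
  assume "finite I"
  then have "cnj (h (lincomb I x b) w) = (\<Sum>i\<in>I. cnj (x i) * cnj (h (b i) w))"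
    by (simp add: herm_lincomb)
  then show ?thesis by (simp only: herm_sym[of w, symmetric])
qed

lemma herm_real: "h u u = of_real (Re (h u u))"
  using herm_sym[of u u] by (simp add: complex_eq_iff)

end

lemma hermitian_form_pencil:
  assumes "hermitian_form Q" "hermitian_form W"
  shows "hermitian_form (\<lambda>u v. Q u v - of_real l * W u v)"
  unfolding hermitian_form_def
proof (intro conjI allI)
  fix u v
  show "Q v u - of_real l * W v u = cnj (Q u v - of_real l * W u v)"
    by (simp add: herm_sym[OF assms(1), of v u] herm_sym[OF assms(2), of v u])
qed (simp_all add: herm_add[OF assms(1)] herm_add[OF assms(2)] herm_scale[OF assms(1)]
    herm_scale[OF assms(2)] algebra_simps)

lemma hermitian_form_uminus:
  assumes "hermitian_form h"
  shows "hermitian_form (\<lambda>u v. - h u v)"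
  unfolding hermitian_form_def
proof (intro conjI allI)
  fix u v
  show "- h v u = cnj (- h u v)" by (simp add: herm_sym[OF assms, of v u])
qed (simp_all add: herm_add[OF assms] herm_scale[OF assms])

text \<open>Sequences have infinitely many entries, and this condition makes the space effectively
  \<open>(N + 1)\<close>-dimensional. Only the left argument is mentioned, since Hermitian symmetry
  transfers the property to the right one.\<close>

definition depends_upto :: "nat \<Rightarrow> ((nat \<Rightarrow> complex) \<Rightarrow> (nat \<Rightarrow> complex) \<Rightarrow> complex) \<Rightarrow> bool" where
  "depends_upto N h \<longleftrightarrow> (\<forall>u v w. (\<forall>n\<le>N. u n = v n) \<longrightarrow> h u w = h v w)"

lemma depends_uptoD: "depends_upto N h \<Longrightarrow> (\<And>n. n \<le> N \<Longrightarrow> u n = v n) \<Longrightarrow> h u w = h v w"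
  unfolding depends_upto_def by blast

lemma depends_uptoD_right:
  "depends_upto N h \<Longrightarrow> hermitian_form h \<Longrightarrow> (\<And>n. n \<le> N \<Longrightarrow> u n = v n) \<Longrightarrow> h w u = h w v"
  by (simp only: herm_sym[of h w] depends_uptoD[of N h u v w])

lemma herm_expand:
  assumes "hermitian_form h" "depends_upto N h"
  shows "h u v = (\<Sum>i\<le>N. \<Sum>j\<le>N. u i * cnj (v j) * h (unit_seq i) (unit_seq j))"
proof -
  have *: "y n = lincomb {..N} y unit_seq n" if "n \<le> N" for y n
    using that by (simp add: lincomb_def unit_seq_def if_distrib cong: if_cong)
  have "h u v = h (lincomb {..N} u unit_seq) (lincomb {..N} v unit_seq)"
    by (rule trans[OF depends_uptoD[OF assms(2) *] depends_uptoD_right[OF assms(2,1) *]])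
  also have "\<dots> = (\<Sum>i\<le>N. u i * h (unit_seq i) (lincomb {..N} v unit_seq))"
    by (simp only: herm_lincomb[OF assms(1)] finite_atMost)
  also have "\<dots> = (\<Sum>i\<le>N. u i * (\<Sum>j\<le>N. cnj (v j) * h (unit_seq i) (unit_seq j)))"
    by (simp only: herm_lincomb_right[OF assms(1)] finite_atMost)
  finally show ?thesis by (simp add: sum_distrib_left mult.assoc)
qed

lemma continuous_on_coordinate: "continuous_on S (\<lambda>v :: nat \<Rightarrow> complex. v n)"
  by (rule continuous_on_subset[OF continuous_on_product_coordinates subset_UNIV])

text \<open>In the product topology on sequences every coordinate is continuous, and the form is a
  finite polynomial in coordinates and their conjugates. This is what the compactness argument for
  the Rayleigh quotient rests on.\<close>

lemma herm_continuous:
  assumes "hermitian_form h" "depends_upto N h"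
  shows "continuous_on S (\<lambda>v. h v v)" "continuous_on S (\<lambda>v. h v u)"
  by (subst herm_expand[OF assms], intro continuous_intros continuous_on_coordinate)+

text \<open>If \<open>F e v\<close> were nonzero, moving from \<open>e\<close> a little in the
  direction \<open>- F e v\<close> along \<open>v\<close> would make the form negative: the
  first-order term dominates the quadratic one.\<close>

lemma psd_null_vector:
  assumes F: "hermitian_form F"
    and add: "\<And>u v. u \<in> V \<Longrightarrow> v \<in> V \<Longrightarrow> (\<lambda>n. u n + v n) \<in> V"
    and scale: "\<And>c u. u \<in> V \<Longrightarrow> (\<lambda>n. c * u n) \<in> V"
    and psd: "\<And>u. u \<in> V \<Longrightarrow> 0 \<le> Re (F u u)"
    and e: "e \<in> V" "F e e = 0" and v: "v \<in> V"
  shows "F e v = 0"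
proof (rule ccontr)
  assume nz: "F e v \<noteq> 0"
  define r where "r = Re (F v v)"
  have r: "0 \<le> r" using psd v by (simp add: r_def)
  \<comment> \<open>Any \<open>s > 0\<close> with \<open>s * r < 2\<close> would do; adding 1 covers
    \<open>r = 0\<close>.\<close>
  define s where "s = 1 / (r + 1)"
  define t where "t = - of_real s * F e v"
  have "0 \<le> Re (F (\<lambda>n. e n + t * v n) (\<lambda>n. e n + t * v n))"
    by (intro psd add scale e v)
  also have "F (\<lambda>n. e n + t * v n) (\<lambda>n. e n + t * v n) =
      cnj t * F e v + t * cnj (F e v) + t * cnj t * F v v"
    using e(2) by (simp add: herm_add[OF F] herm_add_right[OF F] herm_scale[OF F]
        herm_scale_right[OF F] herm_sym[OF F, of v e] algebra_simps)
  also have "\<dots> = of_real ((cmod (F e v))\<^sup>2 * (- 2 * s + s\<^sup>2 * r))"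
  proof -
    have "F e v * cnj (F e v) = of_real ((cmod (F e v))\<^sup>2)"
      by (simp only: complex_norm_square)
    moreover have "cnj t * F e v + t * cnj (F e v) + t * cnj t * F v v =
        F e v * cnj (F e v) * (of_real (- 2 * s + s\<^sup>2 * r))"
      using herm_real[OF F, of v] by (simp add: t_def r_def algebra_simps power2_eq_square)
    ultimately show ?thesis by (simp only: of_real_mult)
  qed
  finally have "0 \<le> (cmod (F e v))\<^sup>2 * (- 2 * s + s\<^sup>2 * r)" by (simp only: Re_complex_of_real)
  moreover have "0 < (cmod (F e v))\<^sup>2" using nz by simp
  ultimately have "0 \<le> - 2 * s + s\<^sup>2 * r" by (smt (verit) mult_pos_neg)
  moreover have "s > 0" using r by (simp add: s_def)
  moreover have "s * r \<le> 1" using r by (simp add: s_def)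
  then have "s\<^sup>2 * r \<le> s"
    using \<open>s > 0\<close> mult_left_mono[of "s * r" 1 s] by (simp add: power2_eq_square mult.assoc)
  ultimately show False by linarith
qed

section \<open>Rayleigh quotients and simultaneous diagonalization\<close>

lemma compact_bounded_seqs: "compact {v :: nat \<Rightarrow> complex. \<forall>n. cmod (v n) \<le> B}"
proof -
  have "compactin (product_topology (\<lambda>_. euclidean) UNIV) (PiE UNIV (\<lambda>_::nat. cball (0::complex) B))"
    by (subst compactin_PiE) auto
  moreover have "PiE UNIV (\<lambda>_::nat. cball (0::complex) B) = {v. \<forall>n. cmod (v n) \<le> B}"
    by (auto simp: PiE_def Pi_def)
  ultimately show ?thesis
    by (simp add: euclidean_product_topology)
qed

text \<open>The minimum \<open>l\<close> of \<open>Q\<close> on the \<open>W\<close>-unit sphere of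
  \<open>V\<close> is attained, since the sphere is closed and its entries are bounded. Then
  \<open>Q - l W\<close> is positive semidefinite on \<open>V\<close> and vanishes at the minimizer,
  which is therefore orthogonal to all of \<open>V\<close> for this form.\<close>

lemma rayleigh_eigenvector:
  assumes Q: "hermitian_form Q" "depends_upto N Q" and W: "hermitian_form W" "depends_upto N W"
    and add: "\<And>u v. u \<in> V \<Longrightarrow> v \<in> V \<Longrightarrow> (\<lambda>n. u n + v n) \<in> V"
    and scale: "\<And>c u. u \<in> V \<Longrightarrow> (\<lambda>n. c * u n) \<in> V"
    and "closed V"
    and pos: "\<And>v. v \<in> V \<Longrightarrow> v \<noteq> (\<lambda>_. 0) \<Longrightarrow> 0 < Re (W v v)"
    and bound: "\<And>v n. v \<in> V \<Longrightarrow> W v v = 1 \<Longrightarrow> cmod (v n) \<le> B"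
    and nz: "v0 \<in> V" "v0 \<noteq> (\<lambda>_. 0)"
  shows "\<exists>e\<in>V. \<exists>l::real. W e e = 1 \<and> (\<forall>v\<in>V. Q e v = of_real l * W e v)"
proof -
  define S where "S = V \<inter> {v. W v v = 1}"
  have normalize: "\<exists>t::real. t > 0 \<and> (\<lambda>n. of_real t * v n) \<in> S" if "v \<in> V" "v \<noteq> (\<lambda>_. 0)" for v
  proof -
    define t where "t = 1 / sqrt (Re (W v v))"
    have "t > 0" using pos[OF that] by (simp add: t_def)
    moreover have "W (\<lambda>n. of_real t * v n) (\<lambda>n. of_real t * v n) = 1"
    proof -
      have "W (\<lambda>n. of_real t * v n) (\<lambda>n. of_real t * v n) = of_real (t * t * Re (W v v))"
        using herm_real[OF W(1), of v] by (simp add: herm_scale[OF W(1)] herm_scale_right[OF W(1)])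
      also have "t * t * Re (W v v) = 1"
        using pos[OF that] by (simp add: t_def field_simps)
      finally show ?thesis by simp
    qed
    ultimately show ?thesis using scale[OF that(1)] by (auto simp: S_def)
  qed
  have "closed {v. W v v = 1}"
    by (intro closed_Collect_eq herm_continuous[OF W] continuous_intros)
  with \<open>closed V\<close> have "closed S" unfolding S_def by (rule closed_Int)
  moreover have "S \<subseteq> {v. \<forall>n. cmod (v n) \<le> B}" using bound by (auto simp: S_def)
  ultimately have "compact ({v. \<forall>n. cmod (v n) \<le> B} \<inter> S)" and
    "{v. \<forall>n. cmod (v n) \<le> B} \<inter> S = S"
    using compact_Int_closed[OF compact_bounded_seqs] by blast+
  then have "compact S" by simp
  moreover have "S \<noteq> {}" using normalize[OF nz] by auto
  moreover have "continuous_on S (\<lambda>v. Re (Q v v))"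
    by (intro continuous_intros herm_continuous[OF Q])
  ultimately have "\<exists>e\<in>S. \<forall>v\<in>S. Re (Q e e) \<le> Re (Q v v)"
    by (rule continuous_attains_inf)
  then obtain e where e: "e \<in> S" "\<And>v. v \<in> S \<Longrightarrow> Re (Q e e) \<le> Re (Q v v)"
    by blast
  define l where "l = Re (Q e e)"
  define F where "F = (\<lambda>u v. Q u v - of_real l * W u v)"
  have F: "hermitian_form F"
    unfolding F_def by (rule hermitian_form_pencil[OF Q(1) W(1)])
  have Wee: "W e e = 1" using e by (simp add: S_def)
  have psd: "0 \<le> Re (F v v)" if v: "v \<in> V" for v
  proof (cases "v = (\<lambda>_. 0)")
    case True
    then show ?thesis by (simp add: herm_zero[OF F])
  next
    case False
    then obtain t where t: "t > 0" "(\<lambda>n. of_real t * v n) \<in> S" using normalize[OF v False] by blast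
    have "Re (F (\<lambda>n. of_real t * v n) (\<lambda>n. of_real t * v n)) \<ge> 0"
      using e(2)[OF t(2)] t(2) by (simp add: F_def l_def S_def)
    then have "t * (t * Re (F v v)) \<ge> 0"
      by (simp add: herm_scale[OF F] herm_scale_right[OF F])
    then show ?thesis using t(1) by (simp add: zero_le_mult_iff)
  qed
  have Fee: "F e e = 0"
    using Wee herm_real[OF Q(1), of e] by (simp add: F_def l_def)
  have eV: "e \<in> V" using e(1) by (simp add: S_def)
  have "F e v = 0" if "v \<in> V" for v
    by (rule psd_null_vector[OF F add scale psd eV Fee that])
  then have "\<forall>v\<in>V. Q e v = of_real l * W e v" by (simp add: F_def)
  then show ?thesis using eV Wee by blast
qed

lemma lincomb_closed:
  assumes "\<And>u v. u \<in> V \<Longrightarrow> v \<in> V \<Longrightarrow> (\<lambda>n. u n + v n) \<in> V"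
    and "\<And>c u. u \<in> V \<Longrightarrow> (\<lambda>n. c * u n) \<in> V"
    and "(\<lambda>_. 0) \<in> V" and "finite I" and "\<And>i. i \<in> I \<Longrightarrow> b i \<in> V"
  shows "lincomb I x b \<in> V"
  using assms(4,5)
proof (induction rule: finite_induct)
  case empty
  then show ?case using assms(3) by (simp add: lincomb_def)
next
  case (insert i I)
  have "lincomb (insert i I) x b = (\<lambda>n. x i * b i n + lincomb I x b n)"
    using insert by (auto simp: lincomb_def)
  then show ?case using insert assms(1,2) by simp
qed

lemma orthonormal_lincomb:
  assumes "hermitian_form W" "finite I" "i \<in> I"
    and "\<And>i j. i \<in> I \<Longrightarrow> j \<in> I \<Longrightarrow> W (e i) (e j) = of_bool (i = j)"
  shows "W (lincomb I x e) (e i) = x i"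
proof -
  have "W (lincomb I x e) (e i) = (\<Sum>j\<in>I. x j * of_bool (j = i))"
    using assms by (simp add: herm_lincomb)
  also have "\<dots> = x i" using assms(2,3) by (simp add: of_bool_def if_distrib cong: if_cong)
  finally show ?thesis .
qed

text \<open>A \<open>W\<close>-orthonormal system of eigenvectors of maximal size is taken; sizes
  are bounded because such a system is independent on the entries up to \<open>N\<close>. Its
  \<open>W\<close>-orthogonal complement in \<open>V\<close> must be trivial, as a Rayleigh
  minimizer there would enlarge the system.\<close>

lemma simultaneous_diagonalization:
  assumes Q: "hermitian_form Q" "depends_upto N Q" and W: "hermitian_form W" "depends_upto N W"
    and add: "\<And>u v. u \<in> V \<Longrightarrow> v \<in> V \<Longrightarrow> (\<lambda>n. u n + v n) \<in> V"
    and scale: "\<And>c u. u \<in> V \<Longrightarrow> (\<lambda>n. c * u n) \<in> V"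
    and zero: "(\<lambda>_. 0) \<in> V"
    and "closed V"
    and pos: "\<And>v. v \<in> V \<Longrightarrow> v \<noteq> (\<lambda>_. 0) \<Longrightarrow> 0 < Re (W v v)"
    and bound: "\<And>v n. v \<in> V \<Longrightarrow> W v v = 1 \<Longrightarrow> cmod (v n) \<le> B"
  shows "\<exists>(m::nat) e l. (\<forall>i<m. e i \<in> V) \<and> (\<forall>i<m. \<forall>j<m. W (e i) (e j) = of_bool (i = j)) \<and>
     (\<forall>i<m. \<forall>v\<in>V. Q (e i) v = of_real (l i :: real) * W (e i) v) \<and>
     (\<forall>v\<in>V. v = lincomb {..<m} (\<lambda>i. W v (e i)) e)"
proof -
  define P where "P = (\<lambda>(m::nat) e l. (\<forall>i<m. e i \<in> V) \<and> (\<forall>i<m. \<forall>j<m. W (e i) (e j) = of_bool (i = j)) \<and>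
     (\<forall>i<m. \<forall>v\<in>V. Q (e i) v = of_real (l i :: real) * W (e i) v))"
  have bounded: "m \<le> N + 1" if "P m e l" for m e l
  proof (rule ccontr)
    assume "\<not> m \<le> N + 1"
    then obtain x where x: "\<exists>i<m. x i \<noteq> 0" "\<forall>n\<le>N. lincomb {..<m} x e n = 0"
      using lincomb_dependent[of "{..<m}" N e] by auto
    have "x i = 0" if "i < m" for i
    proof -
      have "W (lincomb {..<m} x e) (e i) = x i"
        by (rule orthonormal_lincomb[OF W(1)]) (use \<open>P m e l\<close> that in \<open>auto simp: P_def\<close>)
      moreover have "W (lincomb {..<m} x e) (e i) = W (\<lambda>_. 0) (e i)"
        by (rule depends_uptoD[OF W(2)]) (use x in auto)
      ultimately show ?thesis by (simp add: herm_zero[OF W(1)])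
    qed
    then show False using x(1) by auto
  qed
  have "\<exists>e l. P (0::nat) e l" by (auto simp: P_def)
  moreover have "\<forall>m::nat. (\<exists>e l. P m e l) \<longrightarrow> m \<le> N + 1" using bounded by blast
  ultimately obtain m where m: "\<exists>e l. P m e l" "\<And>k. \<exists>e l. P k e l \<Longrightarrow> k \<le> m"
    using GreatestI_nat[of "\<lambda>m. \<exists>e l. P m e l" 0 "N + 1"]
      Greatest_le_nat[of "\<lambda>m. \<exists>e l. P m e l" _ "N + 1"] by blast
  then obtain e l where P: "P m e l" by blast
  define V' where "V' = {v \<in> V. \<forall>i<m. W v (e i) = 0}"
  have triv: "v = (\<lambda>_. 0)" if "v \<in> V'" for v
  proof (rule ccontr)
    assume nz: "v \<noteq> (\<lambda>_. 0)"
    have "closed {v. \<forall>i<m. W v (e i) = 0}"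
    proof -
      have "{v. \<forall>i<m. W v (e i) = 0} = (\<Inter>i\<in>{..<m}. {v. W v (e i) = 0})" by auto
      moreover have "closed {v. W v (e i) = 0}" for i
        by (intro closed_Collect_eq herm_continuous[OF W] continuous_intros)
      ultimately show ?thesis by auto
    qed
    moreover have "V' = V \<inter> {v. \<forall>i<m. W v (e i) = 0}" by (auto simp: V'_def)
    ultimately have cl: "closed V'" using \<open>closed V\<close> by auto
    have "\<exists>e\<in>V'. \<exists>l::real. W e e = 1 \<and> (\<forall>v\<in>V'. Q e v = of_real l * W e v)"
      by (rule rayleigh_eigenvector[OF Q W _ _ cl _ _ that nz, where B = B])
        (auto simp: V'_def add scale pos bound herm_add[OF W(1)] herm_scale[OF W(1)])
    then obtain f k where f: "f \<in> V'" "W f f = 1" "\<And>v. v \<in> V' \<Longrightarrow> Q f v = of_real (k::real) * W f v"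
      by blast
    have f0: "W f (e i) = 0" "W (e i) f = 0" "Q f (e i) = 0" if "i < m" for i
    proof -
      show 1: "W f (e i) = 0" using f(1) that by (simp add: V'_def)
      then show 2: "W (e i) f = 0" by (metis herm_sym[OF W(1)] complex_cnj_zero)
      have "Q (e i) f = of_real (l i) * W (e i) f"
        using P f(1) that by (auto simp: P_def V'_def)
      then show "Q f (e i) = 0" using 2 by (metis herm_sym[OF Q(1)] complex_cnj_zero mult_zero_right)
    qed
    \<comment> \<open>The minimizer satisfies the eigenvalue relation only against the complement
      \<open>V'\<close>. A general \<open>v\<close> is split into its projection \<open>r\<close>
      onto the system, which is orthogonal to \<open>f\<close> for both forms, and a remainder in
      \<open>V'\<close>.\<close>
    have "Q f v = of_real k * W f v" if "v \<in> V" for v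
    proof -
      define r where "r = lincomb {..<m} (\<lambda>i. W v (e i)) e"
      have rV: "r \<in> V" unfolding r_def
        by (rule lincomb_closed[OF add scale zero]) (use P in \<open>auto simp: P_def\<close>)
      have "W r (e i) = W v (e i)" if "i < m" for i
        unfolding r_def by (rule orthonormal_lincomb[OF W(1)]) (use P that in \<open>auto simp: P_def\<close>)
      then have "(\<lambda>n. v n - r n) \<in> V'"
        using add[OF \<open>v \<in> V\<close> scale[OF rV, of "-1"]]
        by (simp add: V'_def herm_diff[OF W(1)])
      then have "Q f (\<lambda>n. v n - r n) = of_real k * W f (\<lambda>n. v n - r n)" by (rule f(3))
      moreover have "Q f r = 0" "W f r = 0"
        using f0 by (simp_all add: r_def herm_lincomb_right[OF Q(1)] herm_lincomb_right[OF W(1)])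
      ultimately show ?thesis by (simp add: herm_diff_right[OF Q(1)] herm_diff_right[OF W(1)])
    qed
    then have "P (Suc m) (e(m := f)) (l(m := k))"
      using P f f0 by (auto simp: P_def V'_def less_Suc_eq)
    then show False using m(2)[of "Suc m"] by auto
  qed
  have "v = lincomb {..<m} (\<lambda>i. W v (e i)) e" if "v \<in> V" for v
  proof -
    define r where "r = lincomb {..<m} (\<lambda>i. W v (e i)) e"
    have rV: "r \<in> V" unfolding r_def
      by (rule lincomb_closed[OF add scale zero]) (use P in \<open>auto simp: P_def\<close>)
    have "W r (e i) = W v (e i)" if "i < m" for i
      unfolding r_def by (rule orthonormal_lincomb[OF W(1)]) (use P that in \<open>auto simp: P_def\<close>)
    then have "(\<lambda>n. v n - r n) \<in> V'"
      using add[OF \<open>v \<in> V\<close> scale[OF rV, of "-1"]]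
      by (simp add: V'_def herm_diff[OF W(1)])
    then have "(\<lambda>n. v n - r n) = (\<lambda>_. 0)" by (rule triv)
    then show ?thesis by (auto simp: r_def fun_eq_iff)
  qed
  then have span: "\<forall>v\<in>V. v = lincomb {..<m} (\<lambda>i. W v (e i)) e" by blast
  show ?thesis
    by (rule exI[of _ m], rule exI[of _ e], rule exI[of _ l], insert P span, unfold P_def,
        elim conjE, intro conjI)
qed

section \<open>Pencils with a one-dimensional kernel\<close>

definition wform :: "nat \<Rightarrow> (nat \<Rightarrow> real) \<Rightarrow> (nat \<Rightarrow> complex) \<Rightarrow> (nat \<Rightarrow> complex) \<Rightarrow> complex" where
  "wform N w u v = (\<Sum>n=1..N. of_real (w n) * u n * cnj (v n))"

lemma wform_hermitian: "hermitian_form (wform N w)"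
  by (auto simp: hermitian_form_def wform_def sum.distrib sum_distrib_left algebra_simps)

lemma wform_cong:
  "(\<And>n. n \<in> {1..N} \<Longrightarrow> u n = u' n) \<Longrightarrow> (\<And>n. n \<in> {1..N} \<Longrightarrow> v n = v' n) \<Longrightarrow>
    wform N w u v = wform N w u' v'"
  by (simp add: wform_def)

lemma wform_depends: "depends_upto N (wform N w)"
  by (auto simp: depends_upto_def intro: wform_cong)

lemma wform_unit_0 [simp]: "wform N w (unit_seq 0) v = 0" "wform N w v (unit_seq 0) = 0"
  by (auto simp: wform_def unit_seq_def)

lemma wform_self: "wform N w v v = of_real (\<Sum>n=1..N. w n * (cmod (v n))\<^sup>2)"
  unfolding wform_def of_real_sum
  by (intro sum.cong refl) (simp only: of_real_mult complex_norm_square mult.assoc)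

text \<open>The eigenvalue relation is required against all test vectors; the test vector
  \<open>unit_seq 0\<close>, on which the weight form vanishes, forces each \<open>e i\<close> into
  the hyperplane \<open>Q y (unit_seq 0) = 0\<close>. The extra term \<open>s * unit_seq 0\<close>
  in the expansion makes one statement fit both cases: \<open>unit_seq 0\<close> lies in this
  hyperplane exactly when \<open>Q\<close> vanishes on it.\<close>

definition pencil_basis ::
  "nat \<Rightarrow> ((nat \<Rightarrow> complex) \<Rightarrow> (nat \<Rightarrow> complex) \<Rightarrow> complex) \<Rightarrow> (nat \<Rightarrow> real) \<Rightarrow> nat \<Rightarrow>
    (nat \<Rightarrow> nat \<Rightarrow> complex) \<Rightarrow> (nat \<Rightarrow> real) \<Rightarrow> bool" where
  "pencil_basis N Q w m e l \<longleftrightarrow>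
     (\<forall>i<m. \<forall>j<m. wform N w (e i) (e j) = of_bool (i = j)) \<and>
     (\<forall>i<m. \<forall>v. Q (e i) v = of_real (l i) * wform N w (e i) v) \<and>
     (\<forall>y. Q y (unit_seq 0) = 0 \<longrightarrow>
        (\<exists>s. \<forall>n\<le>N. y n = lincomb {..<m} (\<lambda>i. wform N w y (e i)) e n + s * unit_seq 0 n))"

text \<open>The vector \<open>g\<close> witnesses that pairing with coordinate \<open>0\<close> is a
  nonzero functional on the coordinates \<open>1, \<dots>, N\<close>. For \<open>c = 0\<close> this
  makes the constraint a genuine one, and \<open>g\<close> together with coordinate \<open>0\<close>
  spans the hyperbolic plane.\<close>

locale pencil =
  fixes N :: nat and Q :: "(nat \<Rightarrow> complex) \<Rightarrow> (nat \<Rightarrow> complex) \<Rightarrow> complex"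
    and w :: "nat \<Rightarrow> real" and c :: real and g :: "nat \<Rightarrow> complex"
  assumes Q: "hermitian_form Q" "depends_upto N Q"
    and w_pos: "\<And>n. n \<in> {1..N} \<Longrightarrow> 0 < w n"
    and Q_00: "Q (unit_seq 0) (unit_seq 0) = of_real c"
    and g_support: "\<And>n. n \<notin> {1..N} \<Longrightarrow> g n = 0"
    and Q_g0: "Q g (unit_seq 0) = 1"
begin

abbreviation "W \<equiv> wform N w"

abbreviation "\<delta>0 \<equiv> unit_seq 0"

lemmas Q_simps = herm_add[OF Q(1)] herm_add_right[OF Q(1)] herm_scale[OF Q(1)]
  herm_scale_right[OF Q(1)] herm_diff[OF Q(1)] herm_diff_right[OF Q(1)]

lemmas W_simps = herm_add[OF wform_hermitian] herm_add_right[OF wform_hermitian]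
  herm_scale[OF wform_hermitian] herm_scale_right[OF wform_hermitian]
  herm_diff[OF wform_hermitian] herm_diff_right[OF wform_hermitian]

lemma Q_0g: "Q \<delta>0 g = 1"
  by (simp add: herm_sym[OF Q(1), of \<delta>0 g] Q_g0)

lemma W_self_pos:
  assumes "v n \<noteq> 0" "n \<in> {1..N}"
  shows "0 < Re (W v v)"
proof -
  have "0 < w n * (cmod (v n))\<^sup>2" using assms w_pos by simp
  also have "\<dots> \<le> (\<Sum>n=1..N. w n * (cmod (v n))\<^sup>2)"
    using assms w_pos by (intro member_le_sum) (auto simp: less_imp_le)
  finally show ?thesis by (simp add: wform_self)
qed

text \<open>All that matters is a bound independent of \<open>n\<close>: the sum dominates each
  \<open>1 / w n\<close>, and \<open>t \<le> 1 + t^2\<close> replaces a square root.\<close>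

lemma W_one_bound:
  assumes "W v v = 1" "n \<in> {1..N}"
  shows "cmod (v n) \<le> 1 + (\<Sum>n=1..N. 1 / w n)"
proof -
  have "w n * (cmod (v n))\<^sup>2 \<le> (\<Sum>n=1..N. w n * (cmod (v n))\<^sup>2)"
    using assms w_pos by (intro member_le_sum) (auto simp: less_imp_le)
  also have "\<dots> = 1" using assms(1) unfolding wform_self by (simp only: of_real_eq_1_iff)
  finally have "(cmod (v n))\<^sup>2 \<le> 1 / w n" using w_pos[OF assms(2)] by (simp add: field_simps)
  also have "\<dots> \<le> (\<Sum>n=1..N. 1 / w n)"
    using assms w_pos by (intro member_le_sum) (auto simp: less_imp_le)
  finally have *: "(cmod (v n))\<^sup>2 \<le> (\<Sum>n=1..N. 1 / w n)" .
  have "cmod (v n) \<le> 1 + (cmod (v n))\<^sup>2"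
    using sum_squares_bound[of "cmod (v n)" "1/2"] zero_le_power2[of "cmod (v n)"]
    by (simp add: power2_eq_square)
  with * show ?thesis by linarith
qed

text \<open>On sequences supported in \<open>1, \<dots>, N\<close> the weight form is definite, so
  diagonalization applies there. Each eigenvector is afterwards given an entry at \<open>0\<close>,
  chosen so that the eigenvalue relation extends to all test vectors.\<close>

theorem pencil_basis_exists: "\<exists>m e l. pencil_basis N Q w m e l"
proof -
  text \<open>The Schur complement of the entry \<open>c\<close>; for \<open>c = 0\<close> the correction term vanishes by
    \<open>x / 0 = 0\<close>, and eliminating the coordinate \<open>0\<close> leaves a linear constraint instead.\<close>
  define Q' where "Q' = (\<lambda>u v. Q u v - Q u \<delta>0 * Q \<delta>0 v / of_real c)"
  define V where "V = {v. (\<forall>n. n \<notin> {1..N} \<longrightarrow> v n = 0) \<and> (c = 0 \<longrightarrow> Q v \<delta>0 = 0)}"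
  have Q': "hermitian_form Q'"
    unfolding hermitian_form_def
  proof (intro conjI allI)
    fix u v
    show "Q' v u = cnj (Q' u v)"
      by (simp add: Q'_def herm_sym[OF Q(1), of v u] herm_sym[OF Q(1), of v \<delta>0]
          herm_sym[OF Q(1), of \<delta>0 u])
  qed (simp_all add: Q'_def Q_simps algebra_simps add_divide_distrib)
  have Q'_dep: "depends_upto N Q'"
    unfolding depends_upto_def
  proof (intro allI impI)
    fix u v z :: "nat \<Rightarrow> complex" assume "\<forall>n\<le>N. u n = v n"
    then have "Q u x = Q v x" for x by (intro depends_uptoD[OF Q(2)]) auto
    then show "Q' u z = Q' v z" by (simp add: Q'_def)
  qed
  have "closed V"
  proof -
    have 1: "closed {v :: nat \<Rightarrow> complex. n \<notin> {1..N} \<longrightarrow> v n = 0}" for n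
    proof (cases "n \<in> {1..N}")
      case False
      have "closed {v :: nat \<Rightarrow> complex. v n = 0}"
        by (intro closed_Collect_eq continuous_on_coordinate continuous_intros)
      then show ?thesis using False by simp
    qed simp
    have 2: "closed {v. c = 0 \<longrightarrow> Q v \<delta>0 = 0}"
    proof (cases "c = 0")
      case True
      have "closed {v. Q v \<delta>0 = 0}"
        by (intro closed_Collect_eq herm_continuous[OF Q] continuous_intros)
      then show ?thesis using True by simp
    qed simp
    have "V = {v. \<forall>n. n \<notin> {1..N} \<longrightarrow> v n = 0} \<inter> {v. c = 0 \<longrightarrow> Q v \<delta>0 = 0}"
      by (auto simp: V_def)
    then show ?thesis using closed_Int[OF closed_Collect_all[OF 1] 2] by simp
  qed
  have V_add: "(\<lambda>n. u n + v n) \<in> V" if "u \<in> V" "v \<in> V" for u v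
    using that by (auto simp: V_def Q_simps)
  have V_scale: "(\<lambda>n. a * u n) \<in> V" if "u \<in> V" for a u
    using that by (auto simp: V_def Q_simps)
  have V_zero: "(\<lambda>_. 0) \<in> V" by (simp add: V_def herm_zero[OF Q(1)])
  have V_pos: "0 < Re (W v v)" if "v \<in> V" "v \<noteq> (\<lambda>_. 0)" for v
  proof -
    obtain n where n: "v n \<noteq> 0" using \<open>v \<noteq> (\<lambda>_. 0)\<close> by auto
    then have "n \<in> {1..N}" using \<open>v \<in> V\<close> by (auto simp: V_def)
    with n show ?thesis by (rule W_self_pos)
  qed
  have V_bound: "cmod (v n) \<le> 1 + (\<Sum>n=1..N. 1 / w n)" if "v \<in> V" "W v v = 1" for v n
  proof (cases "n \<in> {1..N}")
    case True
    then show ?thesis using W_one_bound that by blast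
  next
    case False
    have "0 \<le> (\<Sum>n=1..N. 1 / w n)" using w_pos by (intro sum_nonneg) (auto simp: less_imp_le)
    moreover have "v n = 0" using False \<open>v \<in> V\<close> by (simp add: V_def)
    ultimately show ?thesis by simp
  qed
  have "\<exists>(m::nat) e l. (\<forall>i<m. e i \<in> V) \<and> (\<forall>i<m. \<forall>j<m. W (e i) (e j) = of_bool (i = j)) \<and>
     (\<forall>i<m. \<forall>v\<in>V. Q' (e i) v = of_real (l i :: real) * W (e i) v) \<and>
     (\<forall>v\<in>V. v = lincomb {..<m} (\<lambda>i. W v (e i)) e)"
    by (rule simultaneous_diagonalization[where V = V and W = W and N = N and Q = Q' and
          B = "1 + (\<Sum>n=1..N. 1 / w n)"])
      (fact Q' Q'_dep wform_hermitian wform_depends V_add V_scale V_zero \<open>closed V\<close> V_pos V_bound)+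
  then obtain m :: nat and e l where e: "\<And>i. i < m \<Longrightarrow> e i \<in> V"
    and ortho: "\<And>i j. i < m \<Longrightarrow> j < m \<Longrightarrow> W (e i) (e j) = of_bool (i = j)"
    and eig: "\<And>i v. i < m \<Longrightarrow> v \<in> V \<Longrightarrow> Q' (e i) v = of_real (l i :: real) * W (e i) v"
    and span: "\<And>v. v \<in> V \<Longrightarrow> v = lincomb {..<m} (\<lambda>i. W v (e i)) e"
    by blast
  \<comment> \<open>For \<open>c \<noteq> 0\<close> this value solves
    \<open>Q (e' i) \<delta>0 = 0\<close>. For \<open>c = 0\<close> that equation already holds by
    the constraint in \<open>V\<close>, and \<open>t\<close> is the Lagrange multiplier: it is fixed
    by the eigenvalue relation against \<open>g\<close>, the one direction that \<open>V\<close>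
    misses.\<close>
  define t where "t = (\<lambda>i. if c = 0 then of_real (l i) * W (e i) g - Q (e i) g
    else - Q (e i) \<delta>0 / of_real c)"
  define e' where "e' = (\<lambda>i n. e i n + t i * \<delta>0 n)"
  have We': "W (e' i) v = W (e i) v" "W v (e' i) = W v (e i)" for i v
    unfolding e'_def by (simp_all add: W_simps)
  have Qe': "Q (e' i) v = Q (e i) v + t i * Q \<delta>0 v" for i v
    unfolding e'_def by (simp add: Q_simps)
  have Qe'0: "Q (e' i) \<delta>0 = 0" if "i < m" for i
    using e[OF that] by (cases "c = 0") (auto simp: Qe' Q_00 t_def V_def)
  define restr :: "(nat \<Rightarrow> complex) \<Rightarrow> nat \<Rightarrow> complex"
    where "restr = (\<lambda>v n. if n \<in> {1..N} then v n else 0)"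
  have restr: "v n = restr v n + v 0 * \<delta>0 n" if "n \<le> N" for v n
    using that by (cases n) (auto simp: restr_def unit_seq_def)
  have Q_restr: "Q u v = Q u (restr v) + cnj (v 0) * Q u \<delta>0" for u v
  proof -
    have "Q u v = Q u (\<lambda>n. restr v n + v 0 * \<delta>0 n)"
      by (rule depends_uptoD_right[OF Q(2,1) restr])
    then show ?thesis by (simp add: Q_simps)
  qed
  have Q_restr': "Q v u = Q (restr v) u + v 0 * Q \<delta>0 u" for u v
  proof -
    have "Q v u = Q (\<lambda>n. restr v n + v 0 * \<delta>0 n) u"
      by (rule depends_uptoD[OF Q(2) restr])
    then show ?thesis by (simp add: Q_simps)
  qed
  have W_restr: "W u (restr v) = W u v" "W (restr v) u = W v u" for u v
    by (auto intro!: wform_cong simp: restr_def)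
  have eig': "Q (e' i) v = of_real (l i) * W (e' i) v" if i: "i < m" for i v
  proof -
    have "Q (e' i) (restr v) = of_real (l i) * W (e i) (restr v)"
    proof (cases "c = 0")
      case False
      then have "restr v \<in> V" by (auto simp: V_def restr_def)
      from eig[OF i this] show ?thesis
        using False by (simp add: Qe' t_def Q'_def)
    next
      case True
      define s where "s = Q (restr v) \<delta>0"
      \<comment> \<open>Since \<open>Q g \<delta>0 = 1\<close>, subtracting \<open>s * g\<close>
        restores the constraint. The relation holds against \<open>u\<close> because
        \<open>u\<close> lies in \<open>V\<close>, and against \<open>g\<close> by the choice of
        \<open>t\<close>.\<close>
      define u where "u = (\<lambda>n. restr v n - s * g n)"
      have "u \<in> V" using g_support by (auto simp: V_def u_def restr_def s_def Q_simps Q_g0)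
      then have "Q u \<delta>0 = 0" using True by (simp add: V_def)
      then have "Q \<delta>0 u = 0" by (simp add: herm_sym[OF Q(1), of \<delta>0 u])
      moreover have "Q (e i) u = of_real (l i) * W (e i) u"
        using eig[OF i \<open>u \<in> V\<close>] True by (simp add: Q'_def)
      ultimately have "Q (e' i) u = of_real (l i) * W (e i) u" by (simp add: Qe')
      moreover have "Q (e' i) g = of_real (l i) * W (e i) g"
        using True by (simp add: Qe' Q_0g t_def)
      ultimately show ?thesis by (simp add: u_def Q_simps W_simps algebra_simps)
    qed
    then show ?thesis by (simp add: Q_restr[of _ v] Qe'0[OF i] W_restr We')
  qed
  have "\<exists>s. \<forall>n\<le>N. y n = lincomb {..<m} (\<lambda>i. W y (e' i)) e' n + s * \<delta>0 n" if y: "Q y \<delta>0 = 0" for y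
  proof -
    have "restr y \<in> V"
      using y by (auto simp: V_def restr_def[THEN fun_cong, THEN fun_cong] Q_restr'[of y] Q_00)
    from span[OF this] have "restr y n = (\<Sum>i<m. W y (e i) * e i n)" for n
      unfolding lincomb_def W_restr by (rule fun_cong)
    moreover have "lincomb {..<m} (\<lambda>i. W y (e' i)) e' n =
        (\<Sum>i<m. W y (e i) * (e i n + t i * \<delta>0 n))" for n
      unfolding lincomb_def We' by (simp add: e'_def)
    ultimately have "y n = lincomb {..<m} (\<lambda>i. W y (e' i)) e' n +
        (y 0 - (\<Sum>i<m. W y (e i) * t i)) * \<delta>0 n" if "n \<le> N" for n
      using restr[OF that, of y]
      by (simp add: algebra_simps sum.distrib sum_distrib_left sum_distrib_right)
    then show ?thesis by blast
  qed
  then have "pencil_basis N Q w m e' l"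
    using eig' ortho by (auto simp: pencil_basis_def We')
  then show ?thesis by blast
qed

section \<open>Expansion, cardinality and indices from an eigenbasis\<close>

context
  fixes m e l assumes basis: "pencil_basis N Q w m e l"
begin

lemma basis_ortho: "i < m \<Longrightarrow> j < m \<Longrightarrow> W (e i) (e j) = of_bool (i = j)"
  using basis unfolding pencil_basis_def by blast

lemma basis_eig: "i < m \<Longrightarrow> Q (e i) v = of_real (l i) * W (e i) v"
  using basis unfolding pencil_basis_def by blast

lemma basis_span:
  "Q y \<delta>0 = 0 \<Longrightarrow> \<exists>s. \<forall>n\<le>N. y n = lincomb {..<m} (\<lambda>i. W y (e i)) e n + s * \<delta>0 n"
  using basis unfolding pencil_basis_def by blast

lemma basis_eig_right: "i < m \<Longrightarrow> Q v (e i) = of_real (l i) * W v (e i)"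
  using basis_eig[of i v] herm_sym[OF Q(1), of v "e i"] herm_sym[OF wform_hermitian, of N w v "e i"]
  by simp

lemma basis_Q0: "i < m \<Longrightarrow> Q (e i) \<delta>0 = 0" "i < m \<Longrightarrow> Q \<delta>0 (e i) = 0"
  by (simp_all add: basis_eig basis_eig_right)

lemma W_lincomb_basis: "I \<subseteq> {..<m} \<Longrightarrow> i \<in> I \<Longrightarrow> W (lincomb I x e) (e i) = x i"
  by (rule orthonormal_lincomb[OF wform_hermitian finite_subset[OF _ finite_lessThan]])
    (auto simp: basis_ortho subset_iff)

text \<open>Hermitian symmetry kills the coefficients that belong to other eigenvalues. As
  \<open>\<mu>\<close> is an arbitrary complex number and the \<open>l i\<close> are real, this also
  excludes nonreal eigenvalues.\<close>

lemma eigenvector_in_span: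
  assumes y: "\<And>v. Q y v = \<mu> * W y v"
  shows "\<forall>n\<le>N. y n = lincomb {i. i < m \<and> of_real (l i) = \<mu>} (\<lambda>i. W y (e i)) e n"
proof -
  obtain s where s: "\<And>n. n \<le> N \<Longrightarrow>
      y n = lincomb {..<m} (\<lambda>i. W y (e i)) e n + s * \<delta>0 n"
    using basis_span[of y] y by auto
  have coef: "W y (e i) = 0" if "i < m" "of_real (l i) \<noteq> \<mu>" for i
    using y[of "e i"] basis_eig_right[OF that(1), of y] that(2) by auto
  \<comment> \<open>Testing against \<open>g\<close> isolates the component \<open>s\<close> at
    coordinate \<open>0\<close>: \<open>Q\<close> pairs \<open>\<delta>0\<close> with
    \<open>g\<close> to 1, while \<open>W\<close> does not see \<open>\<delta>0\<close>.\<close>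
  have "Q y g = Q (\<lambda>n. lincomb {..<m} (\<lambda>i. W y (e i)) e n + s * \<delta>0 n) g"
    by (rule depends_uptoD[OF Q(2) s])
  also have "\<dots> = (\<Sum>i<m. W y (e i) * (of_real (l i) * W (e i) g)) + s"
    by (simp add: Q_simps herm_lincomb[OF Q(1)] basis_eig Q_0g)
  also have "(\<Sum>i<m. W y (e i) * (of_real (l i) * W (e i) g)) = \<mu> * (\<Sum>i<m. W y (e i) * W (e i) g)"
    unfolding sum_distrib_left
    by (intro sum.cong refl) (use coef in force)
  also have "(\<Sum>i<m. W y (e i) * W (e i) g) =
      W (\<lambda>n. lincomb {..<m} (\<lambda>i. W y (e i)) e n + s * \<delta>0 n) g"
    by (simp add: W_simps herm_lincomb[OF wform_hermitian])
  also have "\<dots> = W y g"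
    by (rule depends_uptoD[OF wform_depends s, symmetric])
  finally have "s = 0" using y[of g] by simp
  moreover have "lincomb {..<m} (\<lambda>i. W y (e i)) e n =
      lincomb {i. i < m \<and> of_real (l i) = \<mu>} (\<lambda>i. W y (e i)) e n" for n
    unfolding lincomb_def
    by (rule sum.mono_neutral_right) (use coef in auto)
  ultimately show ?thesis using s by auto
qed

text \<open>Together with \<open>\<delta>0\<close>, and also with \<open>g\<close> if
  \<open>c = 0\<close>, the eigenvectors form a basis of the \<open>N + 1\<close> coordinates;
  spanning and independence give the two inequalities.\<close>

lemma basis_card: "m = (if c = 0 then N - 1 else N)"
proof -
  define d where "d = (\<lambda>i. if i < m then e i else if i = m then \<delta>0 else g)"
  define k where "k = (if c = 0 then m + 2 else m + 1)"
  have lc: "lincomb {..<k} x d n =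
      lincomb {..<m} x e n + x m * \<delta>0 n + (if c = 0 then x (Suc m) * g n else 0)" for x n
    by (simp add: lincomb_def k_def d_def)
  have "N + 1 \<le> card {..<k}"
  proof (rule lincomb_spanning)
    fix y :: "nat \<Rightarrow> complex"
    define s where "s = Q y \<delta>0"
    \<comment> \<open>The projection of \<open>y\<close> onto the hyperplane
      \<open>Q z \<delta>0 = 0\<close>, along \<open>g\<close> if \<open>c = 0\<close> and along
      \<open>\<delta>0\<close> otherwise.\<close>
    define z where "z = (\<lambda>n. y n - s * (if c = 0 then g n else \<delta>0 n / of_real c))"
    have "Q z \<delta>0 = 0"
    proof (cases "c = 0")
      case True
      then show ?thesis by (simp add: z_def Q_simps Q_g0 s_def)
    next
      case False
      then have "z = (\<lambda>n. y n - s / of_real c * \<delta>0 n)" by (simp add: z_def)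
      then show ?thesis using False by (simp only: Q_simps Q_00) (simp add: s_def)
    qed
    then obtain r where r: "\<And>n. n \<le> N \<Longrightarrow>
        z n = lincomb {..<m} (\<lambda>i. W z (e i)) e n + r * \<delta>0 n"
      using basis_span by blast
    define x where "x = (\<lambda>i. if i < m then W z (e i)
      else if i = m then r + (if c = 0 then 0 else s / of_real c) else s)"
    have "lincomb {..<m} x e n = lincomb {..<m} (\<lambda>i. W z (e i)) e n" for n
      unfolding lincomb_def by (rule sum.cong) (auto simp: x_def)
    then have "y n = lincomb {..<k} x d n" if "n \<le> N" for n
      using r[OF that] by (auto simp: lc x_def z_def algebra_simps)
    then show "\<exists>x. \<forall>n\<le>N. y n = lincomb {..<k} x d n" by blast
  qed simp
  moreover have "\<not> N + 1 < card {..<k}"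
  proof
    assume "N + 1 < card {..<k}"
    then obtain x where x: "\<exists>i<k. x i \<noteq> 0" "\<And>n. n \<le> N \<Longrightarrow> lincomb {..<k} x d n = 0"
      using lincomb_dependent[of "{..<k}" N d] by auto
    define r where "r = (if c = 0 then x (Suc m) else 0)"
    define z where "z = (\<lambda>n. lincomb {..<m} x e n + x m * \<delta>0 n + r * g n)"
    have z0: "z n = 0" if "n \<le> N" for n
      using x(2)[OF that] by (auto simp: lc z_def r_def split: if_splits)
    have "Q z \<delta>0 = Q (\<lambda>_. 0) \<delta>0" by (rule depends_uptoD[OF Q(2) z0])
    \<comment> \<open>Pairing a vanishing combination with \<open>\<delta>0\<close> removes
      \<open>g\<close>. Next \<open>W\<close> against the \<open>e i\<close> removes the
      eigenvectors, and the entry at \<open>0\<close> removes \<open>\<delta>0\<close>.\<close>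
    then have Qz: "x m * of_real c + r = 0"
      by (simp add: z_def Q_simps herm_lincomb[OF Q(1)] basis_Q0 Q_00 Q_g0 herm_zero[OF Q(1)])
    then have r0: "r = 0" by (auto simp: r_def split: if_splits)
    have xi: "x i = 0" if "i < m" for i
    proof -
      have "W z (e i) = W (\<lambda>_. 0) (e i)" by (rule depends_uptoD[OF wform_depends z0])
      then show ?thesis
        using that r0 by (simp add: z_def W_simps W_lincomb_basis herm_zero[OF wform_hermitian])
    qed
    then have "z 0 = x m" using r0 by (simp add: z_def lincomb_def unit_seq_def)
    then have "x m = 0" using z0 by simp
    then have "x i = 0" if "i < k" for i
      using that xi r0 by (cases "i < m"; cases "i = m") (auto simp: k_def r_def less_Suc_eq split: if_splits)
    then show False using x(1) by blast
  qed
  ultimately show ?thesis by (auto simp: k_def split: if_splits)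
qed

text \<open>The shifted form is nonnegative on the span of the eigenvectors with
  \<open>l i \<ge> \<alpha>\<close>, joined by \<open>\<delta>0\<close> if \<open>c \<ge> 0\<close>.
  A negative definite family meets this span only in 0, so the two dimensions add up to at most
  \<open>N + 1\<close>. Independence of the family is implied by negativity.\<close>

lemma negative_family_bound:
  fixes b :: "nat \<Rightarrow> nat \<Rightarrow> complex"
  assumes neg: "\<And>x. (\<exists>i<k. x i \<noteq> 0) \<Longrightarrow>
    Re (Q (lincomb {..<k} x b) (lincomb {..<k} x b)
      - of_real \<alpha> * W (lincomb {..<k} x b) (lincomb {..<k} x b)) < 0"
  shows "k \<le> card {i. i < m \<and> l i < \<alpha>} + of_bool (c \<le> 0)"
proof (rule ccontr)
  assume less: "\<not> ?thesis"
  define F where "F = (\<lambda>u v. Q u v - of_real \<alpha> * W u v)"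
  have F: "hermitian_form F"
    unfolding F_def by (rule hermitian_form_pencil[OF Q(1) wform_hermitian])
  have F_dep: "depends_upto N F"
    unfolding depends_upto_def
  proof (intro allI impI)
    fix u v z :: "nat \<Rightarrow> complex" assume "\<forall>n\<le>N. u n = v n"
    then have "Q u z = Q v z" "W u z = W v z"
      by (auto intro: depends_uptoD[OF Q(2)] depends_uptoD[OF wform_depends])
    then show "F u z = F v z" by (simp add: F_def)
  qed
  define I where "I = {i. i < m \<and> \<alpha> \<le> l i}"
  \<comment> \<open>The tags keep both families apart. The count works out because
    \<open>m + of_bool (0 \<le> c) + of_bool (c \<le> 0) = N + 1\<close> for every sign of
    \<open>c\<close>.\<close>
  define K where "K = Inl ` {..<k} \<union> Inr ` (I \<union> (if 0 \<le> c then {m} else {}))"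
  define d where "d = (\<lambda>i. case i of Inl j \<Rightarrow> b j | Inr j \<Rightarrow> if j < m then e j else \<delta>0)"
  have finI: "finite I" "m \<notin> I" by (auto simp: I_def)
  have "{..<m} = {i. i < m \<and> l i < \<alpha>} \<union> I" "{i. i < m \<and> l i < \<alpha>} \<inter> I = {}"
    by (auto simp: I_def)
  then have cardm: "m = card {i. i < m \<and> l i < \<alpha>} + card I"
    using finI by (metis card_Un_disjoint card_lessThan finite_Un finite_lessThan)
  have "card K = k + (card I + of_bool (0 \<le> c))"
    unfolding K_def using finI
    by (subst card_Un_disjoint) (auto simp: card_image)
  then have "N + 1 < card K"
    using less cardm basis_card Q_g0 by (cases "c = 0"; cases "c < 0") auto
  then obtain x where x: "\<exists>i\<in>K. x i \<noteq> 0" "\<And>n. n \<le> N \<Longrightarrow> lincomb K x d n = 0"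
    using lincomb_dependent[of K N d] finI by (auto simp: K_def)
  define p where "p = lincomb {..<k} (x \<circ> Inl) b"
  define s where "s = (if 0 \<le> c then x (Inr m) else 0)"
  define r where "r = lincomb I (x \<circ> Inr) e"
  define z where "z = (\<lambda>n. r n + s * \<delta>0 n)"
  have lc: "lincomb K x d n = p n + z n" for n
  proof -
    have "(\<Sum>j\<in>I. x (Inr j) * d (Inr j) n) = r n"
      unfolding r_def lincomb_def by (rule sum.cong) (auto simp: d_def I_def)
    moreover have "lincomb K x d n = (\<Sum>j<k. x (Inl j) * d (Inl j) n) +
        (\<Sum>j\<in>I \<union> (if 0 \<le> c then {m} else {}). x (Inr j) * d (Inr j) n)"
      unfolding lincomb_def K_def using finI
      by (subst sum.union_disjoint) (auto simp: sum.reindex)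
    ultimately show ?thesis
      using finI by (auto simp: p_def lincomb_def z_def s_def d_def)
  qed
  have pz: "p n = - 1 * z n" if "n \<le> N" for n
    using x(2)[OF that] by (simp add: lc eq_neg_iff_add_eq_0)
  have "F p p = F (\<lambda>n. - 1 * z n) (\<lambda>n. - 1 * z n)"
    by (rule trans[OF depends_uptoD[OF F_dep pz] depends_uptoD_right[OF F_dep F pz]])
  also have "\<dots> = F z z" unfolding herm_scale[OF F] herm_scale_right[OF F] by simp
  also have "F z z = F r r + s * cnj s * of_real c"
  proof -
    have "Q r \<delta>0 = 0" "Q \<delta>0 r = 0"
      by (auto simp: r_def herm_lincomb[OF Q(1)] herm_lincomb_right[OF Q(1)] I_def basis_Q0 intro!: sum.neutral)
    then show ?thesis
      by (simp add: z_def F_def Q_simps W_simps Q_00 algebra_simps)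
  qed
  also have "F r r = of_real (\<Sum>i\<in>I. (l i - \<alpha>) * (cmod (x (Inr i)))\<^sup>2)"
  proof -
    have "F r r = (\<Sum>i\<in>I. x (Inr i) * F (e i) r)"
      using finI by (simp add: r_def herm_lincomb[OF F])
    also have "\<dots> = (\<Sum>i\<in>I. of_real ((l i - \<alpha>) * (cmod (x (Inr i)))\<^sup>2))"
    proof (rule sum.cong)
      fix i assume i: "i \<in> I"
      have "W r (e i) = x (Inr i)"
        unfolding r_def using W_lincomb_basis[of I i "x \<circ> Inr"] i by (auto simp: I_def)
      then have "W (e i) r = cnj (x (Inr i))" by (simp add: herm_sym[OF wform_hermitian, of N w "e i" r])
      then have "x (Inr i) * F (e i) r = of_real (l i - \<alpha>) * (x (Inr i) * cnj (x (Inr i)))"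
        using i by (simp add: F_def basis_eig I_def algebra_simps)
      then show "x (Inr i) * F (e i) r = of_real ((l i - \<alpha>) * (cmod (x (Inr i)))\<^sup>2)"
        by (simp only: of_real_mult complex_norm_square)
    qed simp
    finally show ?thesis by simp
  qed
  also have "s * cnj s * of_real c = of_real (c * (cmod s)\<^sup>2)"
    by (simp only: of_real_mult complex_norm_square mult.commute)
  finally have "Re (F p p) = (\<Sum>i\<in>I. (l i - \<alpha>) * (cmod (x (Inr i)))\<^sup>2) + c * (cmod s)\<^sup>2"
    by (simp only: of_real_add[symmetric] Re_complex_of_real)
  moreover have "0 \<le> (\<Sum>i\<in>I. (l i - \<alpha>) * (cmod (x (Inr i)))\<^sup>2)"
    by (rule sum_nonneg) (auto simp: I_def)
  moreover have "0 \<le> c * (cmod s)\<^sup>2" by (auto simp: s_def)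
  ultimately have "\<not> Re (F p p) < 0" by linarith
  then have xl: "\<forall>i<k. x (Inl i) = 0"
    using neg[of "x \<circ> Inl"] unfolding F_def p_def o_def by blast
  then have "p = (\<lambda>_. 0)" by (simp add: p_def lincomb_def)
  then have z0: "z n = 0" if "n \<le> N" for n using pz[OF that] by simp
  have xr: "x (Inr i) = 0" if i: "i \<in> I" for i
  proof -
    have "W r (e i) = x (Inr i)"
      unfolding r_def using W_lincomb_basis[of I i "x \<circ> Inr"] i by (auto simp: I_def)
    moreover have "W z (e i) = W (\<lambda>_. 0) (e i)" by (rule depends_uptoD[OF wform_depends z0])
    ultimately show ?thesis by (simp add: z_def W_simps herm_zero[OF wform_hermitian])
  qed
  then have "r = (\<lambda>_. 0)" by (simp add: r_def lincomb_def)
  then have "s = 0" using z0[of 0] by (simp add: z_def unit_seq_def)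
  then have "x i = 0" if "i \<in> K" for i
    using that xl xr by (auto simp: K_def s_def split: if_splits)
  then show False using x(1) by blast
qed

text \<open>The eigenvectors below \<open>\<alpha>\<close> are completed by one vector orthogonal to
  all \<open>e i\<close>: \<open>\<delta>0\<close> itself if \<open>c < 0\<close>, and a negative
  vector of the hyperbolic plane if \<open>c = 0\<close>.\<close>

lemma negative_family_exists:
  "\<exists>b :: nat \<Rightarrow> nat \<Rightarrow> complex. \<forall>i < card {i. i < m \<and> l i < \<alpha>} + of_bool (c \<le> 0).
     Re (Q (b i) (b i) - of_real \<alpha> * W (b i) (b i)) < 0 \<and>
     (\<forall>j < card {i. i < m \<and> l i < \<alpha>} + of_bool (c \<le> 0). i \<noteq> j \<longrightarrow>
        Q (b i) (b j) - of_real \<alpha> * W (b i) (b j) = 0)"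
proof -
  define I where "I = {i. i < m \<and> l i < \<alpha>}"
  define F where "F = (\<lambda>u v. Q u v - of_real \<alpha> * W u v)"
  have F: "hermitian_form F"
    unfolding F_def by (rule hermitian_form_pencil[OF Q(1) wform_hermitian])
  note F_simps = herm_add[OF F] herm_add_right[OF F] herm_scale[OF F]
    herm_scale_right[OF F] herm_diff[OF F] herm_diff_right[OF F]
  obtain \<sigma> where \<sigma>: "bij_betw \<sigma> {..<card I} I"
    using ex_bij_betw_nat_finite[of I] by (auto simp: I_def atLeast0LessThan)
  have \<sigma>I: "\<sigma> i < m" "l (\<sigma> i) < \<alpha>" if "i < card I" for i
    using bij_betwE[OF \<sigma>] that by (auto simp: I_def)
  have \<sigma>inj: "\<sigma> i = \<sigma> j \<longleftrightarrow> i = j" if "i < card I" "j < card I" for i j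
    using bij_betw_imp_inj_on[OF \<sigma>] that by (auto simp: inj_on_def)
  have Fe: "F (e i) v = of_real (l i - \<alpha>) * W (e i) v" if "i < m" for i v
    using basis_eig[OF that] by (simp add: F_def algebra_simps)
  have "\<exists>z. c \<le> 0 \<longrightarrow> Re (F z z) < 0 \<and> (\<forall>i<m. F (e i) z = 0)"
  proof -
    consider "c > 0" | "c < 0" | "c = 0" by linarith
    then show ?thesis
    proof cases
      case 2
      then show ?thesis
        by (intro exI[of _ \<delta>0]) (simp add: F_def Q_00 basis_Q0)
    next
      case 3
      \<comment> \<open>Removing the \<open>W\<close>-projection of \<open>g\<close> makes
        \<open>h\<close> orthogonal to every \<open>e i\<close> for the shifted form, without
        changing its pairing with \<open>\<delta>0\<close>.\<close>
      define h where "h = (\<lambda>n. g n - lincomb {..<m} (\<lambda>i. W g (e i)) e n)"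
      have "W h (e i) = 0" if "i < m" for i
        using that by (simp add: h_def W_simps W_lincomb_basis)
      then have Wh: "W (e i) h = 0" if "i < m" for i
        using that by (simp add: herm_sym[OF wform_hermitian, of N w "e i" h])
      have "Q h \<delta>0 = 1"
        by (simp add: h_def Q_simps Q_g0 herm_lincomb[OF Q(1)] basis_Q0)
      then have F1: "F h \<delta>0 = 1" "F \<delta>0 h = 1"
        by (simp_all add: F_def herm_sym[OF Q(1), of \<delta>0 h])
      have F0: "F \<delta>0 \<delta>0 = 0" using 3 by (simp add: F_def Q_00)
      \<comment> \<open>As \<open>\<delta>0\<close> is isotropic and pairs with \<open>h\<close> to
        1, adding \<open>t * \<delta>0\<close> shifts the value by \<open>2 * t\<close>; this choice
        makes its real part \<open>- 1\<close>.\<close>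
      define t where "t = - (Re (F h h) + 1) / 2"
      have "F (\<lambda>n. h n + of_real t * \<delta>0 n) (\<lambda>n. h n + of_real t * \<delta>0 n) = F h h + 2 * of_real t"
        by (simp add: F_simps F1 F0)
      then have "Re (F (\<lambda>n. h n + of_real t * \<delta>0 n) (\<lambda>n. h n + of_real t * \<delta>0 n)) = Re (F h h) + 2 * t"
        by simp
      also have "\<dots> < 0" by (simp add: t_def field_simps)
      finally have "Re (F (\<lambda>n. h n + of_real t * \<delta>0 n) (\<lambda>n. h n + of_real t * \<delta>0 n)) < 0" .
      moreover have "F (e i) (\<lambda>n. h n + of_real t * \<delta>0 n) = 0" if "i < m" for i
        using Wh[OF that] that by (simp add: Fe W_simps)
      ultimately show ?thesis by blast
    qed simp
  qed
  then obtain z where z: "c \<le> 0 \<Longrightarrow> Re (F z z) < 0" "\<And>i. c \<le> 0 \<Longrightarrow> i < m \<Longrightarrow> F (e i) z = 0"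
    by blast
  have z': "F z (e i) = 0" if "c \<le> 0" "i < m" for i
    using z(2)[OF that] by (simp add: herm_sym[OF F, of z "e i"])
  define b where "b = (\<lambda>i. if i < card I then e (\<sigma> i) else z)"
  have "Re (F (b i) (b i)) < 0" if "i < card I + of_bool (c \<le> 0)" for i
    using that \<sigma>I z(1) by (cases "c \<le> 0") (auto simp: b_def Fe basis_ortho split: if_splits)
  moreover have "F (b i) (b j) = 0"
    if "i < card I + of_bool (c \<le> 0)" "j < card I + of_bool (c \<le> 0)" "i \<noteq> j" for i j
    using that \<sigma>I \<sigma>inj z(2) z'
    by (cases "c \<le> 0") (auto simp: b_def Fe basis_ortho split: if_splits)
  ultimately show ?thesis unfolding I_def[symmetric] F_def by blast
qed

end

end

section \<open>The positive index, and stability of negative definiteness\<close>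

lemma pencil_uminus:
  assumes "pencil N Q w c g"
  shows "pencil N (\<lambda>u v. - Q u v) w (- c) (\<lambda>n. - g n)"
proof -
  interpret pencil N Q w c g by fact
  show ?thesis
  proof
    show "hermitian_form (\<lambda>u v. - Q u v)"
      by (rule hermitian_form_uminus[OF Q(1)])
    show "depends_upto N (\<lambda>u v. - Q u v)"
      using Q(2) unfolding depends_upto_def by metis
    show "- Q (\<lambda>n. - g n) \<delta>0 = 1"
      using herm_scale[OF Q(1), of "-1" g \<delta>0] by (simp add: Q_g0)
  qed (use w_pos Q_00 g_support in auto)
qed

text \<open>The positive index of \<open>Q - \<alpha> W\<close> is the negative index of
  \<open>- Q - (- \<alpha>) W\<close>, so the index results for the negated pencil cover eigenvalues
  above \<open>\<alpha>\<close>.\<close>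

lemma pencil_basis_uminus:
  "pencil_basis N Q w m e l \<Longrightarrow> pencil_basis N (\<lambda>u v. - Q u v) w m e (\<lambda>i. - l i)"
  by (simp add: pencil_basis_def)

text \<open>Each off-diagonal term is split evenly by the inequality between arithmetic and
  geometric mean. Since the moduli are symmetric in \<open>i\<close> and \<open>j\<close>, every
  \<open>(cmod (x i))^2\<close> collects exactly the sum over its own row, which the diagonal entry
  outweighs.\<close>

lemma gershgorin_negative_definite:
  fixes b :: "nat \<Rightarrow> nat \<Rightarrow> complex"
  assumes F: "hermitian_form F"
    and dom: "\<And>i. i < k \<Longrightarrow> Re (F (b i) (b i)) + (\<Sum>j\<in>{..<k} - {i}. cmod (F (b i) (b j))) < 0"
    and nz: "\<exists>i<k. x i \<noteq> 0"
  shows "Re (F (lincomb {..<k} x b) (lincomb {..<k} x b)) < 0"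
proof -
  define D where "D = (\<lambda>i j. F (b i) (b j))"
  have sym: "cmod (D j i) = cmod (D i j)" for i j
    unfolding D_def by (subst herm_sym[OF F]) simp
  have split: "(\<Sum>j<k. h j) = h i + (\<Sum>j\<in>{..<k} - {i}. h j)" if "i < k" for h :: "nat \<Rightarrow> real" and i
    using that by (intro sum.remove) auto
  have "F (lincomb {..<k} x b) (lincomb {..<k} x b) = (\<Sum>i<k. x i * F (b i) (lincomb {..<k} x b))"
    by (simp add: herm_lincomb[OF F])
  also have "\<dots> = (\<Sum>i<k. \<Sum>j<k. x i * cnj (x j) * D i j)"
    by (simp add: herm_lincomb_right[OF F] D_def sum_distrib_left mult.assoc)
  finally have "Re (F (lincomb {..<k} x b) (lincomb {..<k} x b)) =
      (\<Sum>i<k. \<Sum>j<k. Re (x i * cnj (x j) * D i j))"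
    by simp
  also have "\<dots> = (\<Sum>i<k. (cmod (x i))\<^sup>2 * Re (D i i) +
      (\<Sum>j\<in>{..<k} - {i}. Re (x i * cnj (x j) * D i j)))"
  proof (rule sum.cong)
    fix i assume "i \<in> {..<k}"
    have "x i * cnj (x i) * D i i = of_real ((cmod (x i))\<^sup>2) * D i i"
      by (simp only: complex_norm_square)
    then have "Re (x i * cnj (x i) * D i i) = (cmod (x i))\<^sup>2 * Re (D i i)"
      by (simp only: Re_complex_of_real Im_complex_of_real times_complex.sel)
    then show "(\<Sum>j<k. Re (x i * cnj (x j) * D i j)) = (cmod (x i))\<^sup>2 * Re (D i i) +
      (\<Sum>j\<in>{..<k} - {i}. Re (x i * cnj (x j) * D i j))"
      using split[of i "\<lambda>j. Re (x i * cnj (x j) * D i j)"] \<open>i \<in> {..<k}\<close> by simp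
  qed simp
  also have "\<dots> \<le> (\<Sum>i<k. (cmod (x i))\<^sup>2 * Re (D i i) +
      (\<Sum>j\<in>{..<k} - {i}. ((cmod (x i))\<^sup>2 / 2 + (cmod (x j))\<^sup>2 / 2) * cmod (D i j)))"
  proof (intro sum_mono add_left_mono)
    fix i j
    have "Re (x i * cnj (x j) * D i j) \<le> cmod (x i) * cmod (x j) * cmod (D i j)"
      using complex_Re_le_cmod[of "x i * cnj (x j) * D i j"] by (simp add: norm_mult)
    also have "\<dots> \<le> ((cmod (x i))\<^sup>2 / 2 + (cmod (x j))\<^sup>2 / 2) * cmod (D i j)"
      using sum_squares_bound[of "cmod (x i)" "cmod (x j)"] by (intro mult_right_mono) auto
    finally show "Re (x i * cnj (x j) * D i j) \<le>
      ((cmod (x i))\<^sup>2 / 2 + (cmod (x j))\<^sup>2 / 2) * cmod (D i j)" .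
  qed
  also have "\<dots> = (\<Sum>i<k. (cmod (x i))\<^sup>2 * (Re (D i i) + (\<Sum>j\<in>{..<k} - {i}. cmod (D i j))))"
  proof -
    \<comment> \<open>Filling the diagonal with zeros turns the sums into full squares of indices,
      so that their order can be exchanged.\<close>
    define S where "S = (\<lambda>i j. if j = i then 0 else cmod (D i j))"
    have S_sym: "S j i = S i j" for i j by (simp add: S_def sym)
    have off: "(\<Sum>j\<in>{..<k} - {i}. h j * cmod (D i j)) = (\<Sum>j<k. h j * S i j)"
      if "i < k" for h i
      unfolding S_def using that by (subst split[of i]) auto
    have "(\<Sum>i<k. \<Sum>j<k. (cmod (x j))\<^sup>2 / 2 * S i j) = (\<Sum>j<k. \<Sum>i<k. (cmod (x j))\<^sup>2 / 2 * S i j)"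
      by (rule sum.swap)
    also have "\<dots> = (\<Sum>j<k. \<Sum>i<k. (cmod (x j))\<^sup>2 / 2 * S j i)"
      by (intro sum.cong refl arg_cong2[of _ _ _ _ "(*)"] S_sym)
    finally have swap: "(\<Sum>i<k. \<Sum>j<k. (cmod (x j))\<^sup>2 / 2 * S i j) =
        (\<Sum>i<k. \<Sum>j<k. (cmod (x i))\<^sup>2 / 2 * S i j)" .
    have "(\<Sum>i<k. \<Sum>j\<in>{..<k} - {i}. ((cmod (x i))\<^sup>2 / 2 + (cmod (x j))\<^sup>2 / 2) * cmod (D i j)) =
        (\<Sum>i<k. \<Sum>j<k. (cmod (x i))\<^sup>2 / 2 * S i j) +
        (\<Sum>i<k. \<Sum>j<k. (cmod (x j))\<^sup>2 / 2 * S i j)"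
      unfolding sum.distrib[symmetric] distrib_right[symmetric]
      by (intro sum.cong refl off) simp
    also have "\<dots> = (\<Sum>i<k. \<Sum>j<k. (cmod (x i))\<^sup>2 * S i j)"
      unfolding swap by (simp only: sum.distrib[symmetric] distrib_right[symmetric] field_sum_of_halves)
    also have "\<dots> = (\<Sum>i<k. (cmod (x i))\<^sup>2 * (\<Sum>j\<in>{..<k} - {i}. cmod (D i j)))"
      unfolding sum_distrib_left by (intro sum.cong refl off[symmetric]) simp
    finally show ?thesis by (simp only: sum.distrib distrib_left)
  qed
  also have "\<dots> < (\<Sum>i<k. 0)"
  proof (rule sum_strict_mono_ex1)
    show "\<forall>i\<in>{..<k}. (cmod (x i))\<^sup>2 * (Re (D i i) + (\<Sum>j\<in>{..<k} - {i}. cmod (D i j))) \<le> 0"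
      using dom by (intro ballI mult_nonneg_nonpos zero_le_power2) (force simp: D_def)
    obtain i where i: "i < k" "x i \<noteq> 0" using nz by blast
    have "(cmod (x i))\<^sup>2 * (Re (D i i) + (\<Sum>j\<in>{..<k} - {i}. cmod (D i j))) < 0"
      using i dom[OF i(1)] by (intro mult_pos_neg) (auto simp: D_def)
    then show "\<exists>i\<in>{..<k}. (cmod (x i))\<^sup>2 * (Re (D i i) + (\<Sum>j\<in>{..<k} - {i}. cmod (D i j))) < 0"
      using i(1) by blast
  qed simp
  finally show ?thesis by simp
qed

text \<open>In the limit the Gram matrix of \<open>b\<close> is diagonal with negative entries,
  hence strictly diagonally dominant, and this is a finite set of open conditions. Convergence on
  the fixed vectors \<open>b i\<close> suffices.\<close>

lemma eventually_negative_definite: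
  fixes b :: "nat \<Rightarrow> nat \<Rightarrow> complex"
  assumes F: "\<And>p. hermitian_form (F p)"
    and neg: "\<And>i. i < k \<Longrightarrow> Re (F0 (b i) (b i)) < 0"
    and ortho: "\<And>i j. i < k \<Longrightarrow> j < k \<Longrightarrow> i \<noteq> j \<Longrightarrow> F0 (b i) (b j) = 0"
    and lim: "\<And>u v. ((\<lambda>p. F p u v) \<longlongrightarrow> F0 u v) \<F>"
  shows "\<forall>\<^sub>F p in \<F>. \<forall>x. (\<exists>i<k. x i \<noteq> 0) \<longrightarrow>
    Re (F p (lincomb {..<k} x b) (lincomb {..<k} x b)) < 0"
proof -
  have "\<forall>\<^sub>F p in \<F>. \<forall>i\<in>{..<k}.
      Re (F p (b i) (b i)) + (\<Sum>j\<in>{..<k} - {i}. cmod (F p (b i) (b j))) < 0"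
  proof (intro eventually_ball_finite ballI)
    fix i assume i: "i \<in> {..<k}"
    have "((\<lambda>p. Re (F p (b i) (b i)) + (\<Sum>j\<in>{..<k} - {i}. cmod (F p (b i) (b j)))) \<longlongrightarrow>
        Re (F0 (b i) (b i)) + (\<Sum>j\<in>{..<k} - {i}. cmod (F0 (b i) (b j)))) \<F>"
      by (intro tendsto_intros lim)
    moreover have "(\<Sum>j\<in>{..<k} - {i}. cmod (F0 (b i) (b j))) = 0"
      using ortho i by (intro sum.neutral) auto
    ultimately show "\<forall>\<^sub>F p in \<F>.
        Re (F p (b i) (b i)) + (\<Sum>j\<in>{..<k} - {i}. cmod (F p (b i) (b j))) < 0"
      using neg i by (intro order_tendstoD(2)) auto
  qed simp
  then show ?thesis
    by eventually_elim (use gershgorin_negative_definite[OF F] in auto)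
qed

section \<open>The energy form of a discrete Sturm--Liouville problem\<close>

text \<open>Only \<open>f\<close> at \<open>0, \<dots>, N - 1\<close> occurs: \<open>f\<close> at
  \<open>N\<close> enters solely through the entry \<open>y (N + 1)\<close>, which the second
  boundary condition determines.\<close>

definition energy_form ::
  "nat \<Rightarrow> sl_eqn \<Rightarrow> real \<Rightarrow> complex \<Rightarrow> real \<Rightarrow> (nat \<Rightarrow> complex) \<Rightarrow> (nat \<Rightarrow> complex) \<Rightarrow> complex" where
  "energy_form N \<omega> a z b u v =
     of_real a * u 0 * cnj (v 0) + cnj z * u N * cnj (v 0) + z * u 0 * cnj (v N) +
     of_real b * u N * cnj (v N) +
     (\<Sum>n<N. of_real (coef_f \<omega> n) * (u (Suc n) - u n) * cnj (v (Suc n) - v n)) +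
     (\<Sum>n=1..N. of_real (coef_q \<omega> n) * u n * cnj (v n))"

lemma energy_form_hermitian: "hermitian_form (energy_form N \<omega> a z b)"
proof -
  have "energy_form N \<omega> a z b (\<lambda>n. u n + v n) x = energy_form N \<omega> a z b u x + energy_form N \<omega> a z b v x"
    for u v x
  proof -
    have "(\<Sum>n<N. of_real (coef_f \<omega> n) * ((u (Suc n) + v (Suc n)) - (u n + v n)) * cnj (x (Suc n) - x n)) =
       (\<Sum>n<N. of_real (coef_f \<omega> n) * (u (Suc n) - u n) * cnj (x (Suc n) - x n)) +
       (\<Sum>n<N. of_real (coef_f \<omega> n) * (v (Suc n) - v n) * cnj (x (Suc n) - x n))"
      by (simp only: sum.distrib[symmetric]) (intro sum.cong refl, simp add: algebra_simps)
    moreover have "(\<Sum>n=1..N. of_real (coef_q \<omega> n) * (u n + v n) * cnj (x n)) =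
       (\<Sum>n=1..N. of_real (coef_q \<omega> n) * u n * cnj (x n)) +
       (\<Sum>n=1..N. of_real (coef_q \<omega> n) * v n * cnj (x n))"
      by (simp only: sum.distrib[symmetric]) (intro sum.cong refl, simp add: algebra_simps)
    ultimately show ?thesis by (simp only: energy_form_def) (simp only: algebra_simps)
  qed
  moreover have "energy_form N \<omega> a z b (\<lambda>n. c * u n) x = c * energy_form N \<omega> a z b u x" for c u x
  proof -
    have "(\<Sum>n<N. of_real (coef_f \<omega> n) * (c * u (Suc n) - c * u n) * cnj (x (Suc n) - x n)) =
       c * (\<Sum>n<N. of_real (coef_f \<omega> n) * (u (Suc n) - u n) * cnj (x (Suc n) - x n))"
      by (simp only: sum_distrib_left) (intro sum.cong refl, simp add: algebra_simps)
    moreover have "(\<Sum>n=1..N. of_real (coef_q \<omega> n) * (c * u n) * cnj (x n)) =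
       c * (\<Sum>n=1..N. of_real (coef_q \<omega> n) * u n * cnj (x n))"
      by (simp only: sum_distrib_left) (intro sum.cong refl, simp add: algebra_simps)
    ultimately show ?thesis by (simp only: energy_form_def) (simp only: algebra_simps)
  qed
  moreover have "energy_form N \<omega> a z b v u = cnj (energy_form N \<omega> a z b u v)" for u v
    by (simp add: energy_form_def mult_ac)
  ultimately show ?thesis unfolding hermitian_form_def by blast
qed

lemma energy_form_depends: "depends_upto N (energy_form N \<omega> a z b)"
  unfolding depends_upto_def
proof (intro allI impI)
  fix u v x :: "nat \<Rightarrow> complex" assume *: "\<forall>n\<le>N. u n = v n"
  have "(\<Sum>n<N. of_real (coef_f \<omega> n) * (u (Suc n) - u n) * cnj (x (Suc n) - x n)) =
      (\<Sum>n<N. of_real (coef_f \<omega> n) * (v (Suc n) - v n) * cnj (x (Suc n) - x n))"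
    using * by (intro sum.cong) auto
  moreover have "(\<Sum>n=1..N. of_real (coef_q \<omega> n) * u n * cnj (x n)) =
      (\<Sum>n=1..N. of_real (coef_q \<omega> n) * v n * cnj (x n))"
    using * by (intro sum.cong) auto
  ultimately show "energy_form N \<omega> a z b u x = energy_form N \<omega> a z b v x"
    using * by (simp add: energy_form_def)
qed

lemma eqn_spaceD:
  assumes "\<omega> \<in> eqn_space N"
  shows "n \<le> N \<Longrightarrow> coef_f \<omega> n \<noteq> 0" "n \<in> {1..N} \<Longrightarrow> 0 < coef_w \<omega> n"
  using assms by (auto simp: eqn_space_def coef_f_def coef_w_def)

text \<open>The value at coordinate \<open>0\<close> collects \<open>a\<close> from the boundary and
  \<open>f\<close> at \<open>0\<close> from the first difference. Coordinate \<open>1\<close>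
  couples to it by minus \<open>f\<close> at \<open>0\<close>, which gives \<open>g\<close>; with
  \<open>N \<ge> 2\<close> it differs from coordinate \<open>N\<close>, whose coupling involves
  \<open>z\<close>.\<close>

lemma energy_form_pencil:
  assumes "2 \<le> N" "\<omega> \<in> eqn_space N"
  shows "pencil N (energy_form N \<omega> a z b) (coef_w \<omega>) (a + coef_f \<omega> 0)
    (\<lambda>n. - 1 / of_real (coef_f \<omega> 0) * unit_seq 1 n)"
proof
  have sum0: "(\<Sum>n<N. h n) = h 0" if "\<And>n. n \<noteq> 0 \<Longrightarrow> h n = 0" for h :: "nat \<Rightarrow> complex"
    using assms(1) that by (subst sum.remove[of _ 0]) auto
  have E1: "energy_form N \<omega> a z b (unit_seq 1) (unit_seq 0) = - of_real (coef_f \<omega> 0)"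
    unfolding energy_form_def
    by (subst sum0) (use assms(1) in \<open>auto simp: unit_seq_def\<close>)
  show "energy_form N \<omega> a z b (\<lambda>n. - 1 / of_real (coef_f \<omega> 0) * unit_seq 1 n) (unit_seq 0) = 1"
    using eqn_spaceD(1)[OF assms(2), of 0]
    by (subst herm_scale[OF energy_form_hermitian]) (simp add: E1[unfolded One_nat_def])
  show "energy_form N \<omega> a z b (unit_seq 0) (unit_seq 0) = of_real (a + coef_f \<omega> 0)"
    unfolding energy_form_def
    by (subst sum0) (use assms(1) in \<open>auto simp: unit_seq_def\<close>)
qed (use assms in \<open>auto simp: energy_form_hermitian energy_form_depends eqn_spaceD unit_seq_def\<close>)

section \<open>Weak formulation of the boundary value problem\<close>

lemma summation_by_parts:
  fixes D V :: "nat \<Rightarrow> complex"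
  shows "(\<Sum>n<N. D n * (V (Suc n) - V n)) =
    (\<Sum>n=1..N. V n * (D (n - 1) - D n)) + V N * D N - V 0 * D 0"
  by (induction N) (auto simp: algebra_simps)

text \<open>The coefficients of \<open>cnj (v n)\<close> are the residuals of the problem.
  Coordinate \<open>0\<close> carries the first boundary condition, but coordinate \<open>N\<close>
  carries the second one and the equation at \<open>N\<close> together, so the form alone cannot
  separate these two.\<close>

lemma energy_form_by_parts:
  "energy_form N \<omega> a z b y v - \<mu> * wform N (coef_w \<omega>) y v =
     cnj (v 0) * (of_real a * y 0 - quasi_diff \<omega> y 0 + cnj z * y N) +
     cnj (v N) * (z * y 0 + of_real b * y N + quasi_diff \<omega> y N) +
     (\<Sum>n=1..N. cnj (v n) * (- bwd_diff (quasi_diff \<omega> y) n + of_real (coef_q \<omega> n) * y n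
        - \<mu> * of_real (coef_w \<omega> n) * y n))"
proof -
  have "(\<Sum>n<N. of_real (coef_f \<omega> n) * (y (Suc n) - y n) * cnj (v (Suc n) - v n)) =
      (\<Sum>n<N. quasi_diff \<omega> y n * (cnj (v (Suc n)) - cnj (v n)))"
    by (simp add: quasi_diff_def fwd_diff_def)
  also have "\<dots> = (\<Sum>n=1..N. cnj (v n) * (quasi_diff \<omega> y (n - 1) - quasi_diff \<omega> y n)) +
      cnj (v N) * quasi_diff \<omega> y N - cnj (v 0) * quasi_diff \<omega> y 0"
    by (rule summation_by_parts)
  finally have 1: "(\<Sum>n<N. of_real (coef_f \<omega> n) * (y (Suc n) - y n) * cnj (v (Suc n) - v n)) = \<dots>" .
  have 2: "(\<Sum>n=1..N. cnj (v n) * (quasi_diff \<omega> y (n - 1) - quasi_diff \<omega> y n)) +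
      (\<Sum>n=1..N. of_real (coef_q \<omega> n) * y n * cnj (v n)) - \<mu> * wform N (coef_w \<omega>) y v =
     (\<Sum>n=1..N. cnj (v n) * (- bwd_diff (quasi_diff \<omega> y) n + of_real (coef_q \<omega> n) * y n
        - \<mu> * of_real (coef_w \<omega> n) * y n))"
    by (simp only: wform_def sum_distrib_left sum.distrib[symmetric] sum_subtractf[symmetric])
      (intro sum.cong refl, simp add: bwd_diff_def algebra_simps)
  show ?thesis unfolding energy_form_def 1 2[symmetric] by (simp add: algebra_simps)
qed

text \<open>The value at \<open>N + 1\<close> is the one that the second boundary condition prescribes.\<close>

definition bc_extend ::
  "nat \<Rightarrow> sl_eqn \<Rightarrow> complex \<Rightarrow> real \<Rightarrow> (nat \<Rightarrow> complex) \<Rightarrow> nat \<Rightarrow> complex" where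
  "bc_extend N \<omega> z b y n =
     (if n \<le> N then y n
      else if n = Suc N then y N - (z * y 0 + of_real b * y N) / of_real (coef_f \<omega> N)
      else 0)"

lemma vector_4 [simp]:
  "(vector [x, y, z, w] :: 'a::zero^4) $ 1 = x" "(vector [x, y, z, w] :: 'a::zero^4) $ 2 = y"
  "(vector [x, y, z, w] :: 'a::zero^4) $ 3 = z" "(vector [x, y, z, w] :: 'a::zero^4) $ 4 = w"
  unfolding vector_def by simp_all

lemma solves_bc_mat24:
  "solves_bc N \<omega> (mat24 a z b) y \<longleftrightarrow>
     of_real a * y 0 - quasi_diff \<omega> y 0 + cnj z * y N = 0 \<and>
     z * y 0 + of_real b * y N + quasi_diff \<omega> y N = 0"
  by (simp add: solves_bc_def block_A_def block_B_def mat24_def vec_eq_iff forall_2 matrix_vector_mult_def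
      sum_2 vector_4 vector_2 algebra_simps)

lemma solves_bc_mult:
  assumes "solves_bc N \<omega> M y"
  shows "solves_bc N \<omega> (T ** M) y"
proof -
  have "block_A (T ** M) = T ** block_A M" "block_B (T ** M) = T ** block_B M"
    by (simp_all add: block_A_def block_B_def matrix_matrix_mult_def vec_eq_iff)
  then have "block_A (T ** M) *v vector [y 0, quasi_diff \<omega> y 0] +
      block_B (T ** M) *v vector [y N, quasi_diff \<omega> y N] =
      T *v (block_A M *v vector [y 0, quasi_diff \<omega> y 0] + block_B M *v vector [y N, quasi_diff \<omega> y N])"
    by (simp add: matrix_vector_mul_assoc matrix_vector_right_distrib)
  then show ?thesis using assms by (simp add: solves_bc_def)
qed

lemma bc_class_refl: "M \<in> bc_class M"
proof -
  have "M = mat 1 ** M" "invertible (mat 1 :: complex^2^2)"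
    by (simp_all add: invertible_def)
  then show ?thesis unfolding bc_class_def by blast
qed

lemma solves_bc_class: "(\<forall>M \<in> bc_class A. solves_bc N \<omega> M y) \<longleftrightarrow> solves_bc N \<omega> A y"
  using bc_class_refl[of A] solves_bc_mult[of N \<omega> A y] by (auto simp: bc_class_def)

text \<open>The condition on \<open>bc_extend\<close> is the second boundary condition together with
  vanishing beyond \<open>N + 1\<close>. Once it holds, testing with unit sequences recovers each
  equation and the first boundary condition.\<close>

lemma solution_space_weak:
  assumes "\<omega> \<in> eqn_space N"
  shows "solution_space N (\<omega>, bc_class (mat24 a z b)) \<mu> =
    {y. bc_extend N \<omega> z b y = y \<and>
        (\<forall>v. energy_form N \<omega> a z b y v = \<mu> * wform N (coef_w \<omega>) y v)}"
proof (rule Collect_cong[of "\<lambda>y. y \<in> _", unfolded Collect_mem_eq])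
  fix y
  have fN: "coef_f \<omega> N \<noteq> 0" using eqn_spaceD(1)[OF assms] by simp
  have ext: "bc_extend N \<omega> z b y = y \<longleftrightarrow>
      (\<forall>n>N + 1. y n = 0) \<and> z * y 0 + of_real b * y N + quasi_diff \<omega> y N = 0"
  proof -
    have "bc_extend N \<omega> z b y = y \<longleftrightarrow> (\<forall>n>N + 1. y n = 0) \<and>
        y N - (z * y 0 + of_real b * y N) / of_real (coef_f \<omega> N) = y (Suc N)"
      unfolding fun_eq_iff bc_extend_def
      by (metis Suc_eq_plus1 Suc_n_not_le_n leD leI le_SucE less_le_not_le not_less_eq_eq order_le_less)
    also have "y N - (z * y 0 + of_real b * y N) / of_real (coef_f \<omega> N) = y (Suc N) \<longleftrightarrow>
        z * y 0 + of_real b * y N + quasi_diff \<omega> y N = 0"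
      using fN by (simp add: quasi_diff_def fwd_diff_def field_simps) (auto simp: algebra_simps)
    finally show ?thesis .
  qed
  have weak: "(\<forall>v. energy_form N \<omega> a z b y v = \<mu> * wform N (coef_w \<omega>) y v) \<longleftrightarrow>
      solves_eqn N \<omega> \<mu> y \<and> of_real a * y 0 - quasi_diff \<omega> y 0 + cnj z * y N = 0"
    if bc2: "z * y 0 + of_real b * y N + quasi_diff \<omega> y N = 0"
  proof -
    define r where "r = (\<lambda>n. - bwd_diff (quasi_diff \<omega> y) n + of_real (coef_q \<omega> n) * y n
        - \<mu> * of_real (coef_w \<omega> n) * y n)"
    define r0 where "r0 = of_real a * y 0 - quasi_diff \<omega> y 0 + cnj z * y N"
    have eq: "energy_form N \<omega> a z b y v - \<mu> * wform N (coef_w \<omega>) y v =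
        cnj (v 0) * r0 + (\<Sum>n=1..N. cnj (v n) * r n)" for v
      unfolding energy_form_by_parts using bc2 by (simp add: r_def r0_def)
    have "solves_eqn N \<omega> \<mu> y \<longleftrightarrow> (\<forall>n\<in>{1..N}. r n = 0)"
      by (simp add: solves_eqn_def r_def)
    moreover have "(\<forall>v. energy_form N \<omega> a z b y v = \<mu> * wform N (coef_w \<omega>) y v) \<longleftrightarrow>
        (\<forall>v. cnj (v 0) * r0 + (\<Sum>n=1..N. cnj (v n) * r n) = 0)"
      unfolding eq[symmetric] by simp
    moreover have "(\<forall>v. cnj (v 0) * r0 + (\<Sum>n=1..N. cnj (v n) * r n) = 0) \<longleftrightarrow>
        (\<forall>n\<in>{1..N}. r n = 0) \<and> r0 = 0"
    proof
      assume *: "\<forall>v. cnj (v 0) * r0 + (\<Sum>n=1..N. cnj (v n) * r n) = 0"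
      have "r n = 0" if "n \<in> {1..N}" for n
        using *[rule_format, of "unit_seq n"] that
        by (simp add: unit_seq_def if_distrib[of cnj] if_distrib[of "\<lambda>x. x * _"] cong: if_cong)
      moreover have "r0 = 0"
        using *[rule_format, of "unit_seq 0"]
        by (simp add: unit_seq_def if_distrib[of cnj] if_distrib[of "\<lambda>x. x * _"] cong: if_cong)
      ultimately show "(\<forall>n\<in>{1..N}. r n = 0) \<and> r0 = 0" by blast
    qed simp
    ultimately show ?thesis by (simp add: r0_def)
  qed
  show "y \<in> solution_space N (\<omega>, bc_class (mat24 a z b)) \<mu> \<longleftrightarrow> bc_extend N \<omega> z b y = y \<and>
        (\<forall>v. energy_form N \<omega> a z b y v = \<mu> * wform N (coef_w \<omega>) y v)"
    unfolding solution_space_def mem_Collect_eq fst_conv snd_conv solves_bc_class solves_bc_mat24 ext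
    using weak by blast
qed

lemma bc_extend_lincomb:
  "bc_extend N \<omega> z b (lincomb I x e) = lincomb I x (\<lambda>i. bc_extend N \<omega> z b (e i))"
  by (rule ext)
    (auto simp: bc_extend_def lincomb_def sum_distrib_left sum_distrib_right sum.distrib
      sum_subtractf sum_divide_distrib algebra_simps add_divide_distrib)

lemma bc_extend_upto [simp]: "n \<le> N \<Longrightarrow> bc_extend N \<omega> z b y n = y n"
  by (simp add: bc_extend_def)

lemma bc_extend_cong: "(\<And>n. n \<le> N \<Longrightarrow> u n = v n) \<Longrightarrow> bc_extend N \<omega> z b u = bc_extend N \<omega> z b v"
  by (rule ext) (simp add: bc_extend_def)

section \<open>Multiplicities and the list of eigenvalues\<close>

lemma length_filter_sort_map:
  "length (filter P (sort (map l [0..<m]))) = card {i. i < m \<and> P (l i)}"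
proof -
  have "length (filter P (sort (map l [0..<m]))) = length (filter P (map l [0..<m]))"
    by (simp only: size_mset[symmetric] mset_filter mset_sort)
  also have "\<dots> = card {i. i < m \<and> P (l i)}"
    by (auto simp: length_filter_conv_card intro!: arg_cong[of _ _ card])
  finally show ?thesis .
qed

text \<open>Extending the eigenvectors with \<open>l i = \<mu>\<close> to the entry
  \<open>N + 1\<close> gives a basis of the solution space: expansion in the eigenbasis shows
  spanning, orthonormality shows independence.\<close>

lemma eig_mult_pencil_basis:
  assumes N: "2 \<le> N" and \<omega>: "\<omega> \<in> eqn_space N"
    and basis: "pencil_basis N (energy_form N \<omega> a z b) (coef_w \<omega>) m e l"
  shows "eig_mult N (\<omega>, bc_class (mat24 a z b)) \<mu> = card {i. i < m \<and> of_real (l i) = \<mu>}" (is ?dim)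
    and "is_eigenvalue N (\<omega>, bc_class (mat24 a z b)) \<mu> \<longleftrightarrow> (\<exists>i<m. of_real (l i) = \<mu>)" (is ?eigen)
proof -
  define Q where "Q = energy_form N \<omega> a z b"
  define W where "W = wform N (coef_w \<omega>)"
  interpret pencil N Q "coef_w \<omega>" "a + coef_f \<omega> 0" "\<lambda>n. - 1 / of_real (coef_f \<omega> 0) * unit_seq 1 n"
    unfolding Q_def by (rule energy_form_pencil[OF N \<omega>])
  note basis' = basis[folded Q_def]
  define I where "I = {i. i < m \<and> of_real (l i) = \<mu>}"
  define S where "S = {y. bc_extend N \<omega> z b y = y \<and> (\<forall>v. Q y v = \<mu> * W y v)}"
  have S: "solution_space N (\<omega>, bc_class (mat24 a z b)) \<mu> = S"
    unfolding S_def Q_def W_def by (rule solution_space_weak[OF \<omega>])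
  define E where "E = (\<lambda>i. bc_extend N \<omega> z b (e i))"
  have QE: "Q (E i) v = Q (e i) v" for i v
    by (rule depends_uptoD[OF Q(2)]) (simp add: E_def)
  have WE: "W (E i) v = W (e i) v" for i v
    unfolding W_def by (rule depends_uptoD[OF wform_depends]) (simp add: E_def)
  have finI: "finite I" by (simp add: I_def)
  have ortho: "W (E i) (e j) = of_bool (i = j)" if "i \<in> I" "j \<in> I" for i j
    unfolding WE unfolding W_def by (rule basis_ortho[OF basis']) (use that in \<open>auto simp: I_def\<close>)
  have E_S: "E i \<in> S" if "i \<in> I" for i
  proof -
    have "bc_extend N \<omega> z b (E i) = E i"
      unfolding E_def by (rule bc_extend_cong) simp
    moreover have "Q (E i) v = \<mu> * W (E i) v" for v
      using that basis_eig[OF basis', of i v] by (simp add: QE WE) (simp add: W_def I_def)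
    ultimately show ?thesis by (simp add: S_def)
  qed
  have inj: "inj_on E I"
  proof (rule inj_onI, rule ccontr)
    fix i j assume "i \<in> I" "j \<in> I" "E i = E j" "i \<noteq> j"
    then show False using ortho[of i j] ortho[of j j] by simp
  qed
  have S_span: "S \<subseteq> cseq.span (E ` I)"
  proof
    fix y assume y: "y \<in> S"
    then have "y = bc_extend N \<omega> z b y" by (simp add: S_def)
    also have "\<dots> = bc_extend N \<omega> z b (lincomb I (\<lambda>i. W y (e i)) e)"
    proof (rule bc_extend_cong)
      fix n assume "n \<le> N"
      have "\<And>v. Q y v = \<mu> * wform N (coef_w \<omega>) y v" using y by (simp add: S_def W_def)
      from eigenvector_in_span[OF basis' this] \<open>n \<le> N\<close>
      show "y n = lincomb I (\<lambda>i. W y (e i)) e n" by (simp add: I_def W_def)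
    qed
    also have "\<dots> = lincomb I (\<lambda>i. W y (e i)) E"
      unfolding E_def by (rule bc_extend_lincomb)
    also have "\<dots> \<in> cseq.span (E ` I)"
    proof (rule lincomb_closed)
      fix u v assume "u \<in> cseq.span (E ` I)" "v \<in> cseq.span (E ` I)"
      then have "u + v \<in> cseq.span (E ` I)" by (rule cseq.span_add)
      then show "(\<lambda>n. u n + v n) \<in> cseq.span (E ` I)" by (simp add: plus_fun_def)
    next
      show "(\<lambda>_. 0) \<in> cseq.span (E ` I)"
        using cseq.span_zero[of "E ` I"] by (simp add: zero_fun_def)
    qed (auto intro: cseq.span_scale cseq.span_base finI)
    finally show "y \<in> cseq.span (E ` I)" .
  qed
  have indep: "\<not> cseq.dependent (E ` I)"
  proof
    assume "cseq.dependent (E ` I)"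
    then obtain i where i: "i \<in> I" "E i \<in> cseq.span (E ` I - {E i})"
      unfolding cseq.dependent_def by blast
    \<comment> \<open>The sequences that are \<open>W\<close>-orthogonal to \<open>e i\<close> form
      a subspace that contains all the other vectors but not \<open>E i\<close>.\<close>
    have "cseq.subspace {v. W v (e i) = 0}"
    proof (rule cseq.subspaceI)
      show "0 \<in> {v. W v (e i) = 0}" by (simp add: zero_fun_def W_def herm_zero[OF wform_hermitian])
    qed (simp_all add: plus_fun_def W_def herm_add[OF wform_hermitian] herm_scale[OF wform_hermitian])
    moreover have "E ` I - {E i} \<subseteq> {v. W v (e i) = 0}"
      using ortho i(1) by auto
    ultimately have "E i \<in> {v. W v (e i) = 0}"
      using cseq.span_minimal i(2) by blast
    then show False using ortho[OF i(1) i(1)] by simp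
  qed
  have "cseq.dim S = card (E ` I)"
    by (rule cseq.dim_unique[OF _ S_span indep]) (use E_S in auto)
  then show ?dim
    unfolding eig_mult_def S I_def[symmetric] using inj by (simp add: card_image)
  show ?eigen
  proof
    assume "is_eigenvalue N (\<omega>, bc_class (mat24 a z b)) \<mu>"
    then obtain y where y: "y \<in> S" "y \<noteq> 0" unfolding is_eigenvalue_def S by blast
    have "I \<noteq> {}"
    proof
      assume "I = {}"
      then show False using S_span y by auto
    qed
    then show "\<exists>i<m. of_real (l i) = \<mu>" by (auto simp: I_def)
  next
    assume "\<exists>i<m. of_real (l i) = \<mu>"
    then obtain i where i: "i \<in> I" by (auto simp: I_def)
    have "E i \<noteq> 0"
    proof
      assume "E i = 0"
      then have "W (E i) (e i) = 0" by (simp add: zero_fun_def W_def herm_zero[OF wform_hermitian])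
      then show False using ortho[OF i i] by simp
    qed
    then show "is_eigenvalue N (\<omega>, bc_class (mat24 a z b)) \<mu>"
      using E_S[OF i] unfolding is_eigenvalue_def S by blast
  qed
qed

lemma eigenvalue_list_pencil_basis:
  assumes N: "2 \<le> N" and \<omega>: "\<omega> \<in> eqn_space N"
    and basis: "pencil_basis N (energy_form N \<omega> a z b) (coef_w \<omega>) m e l"
  shows "eigenvalue_list N (\<omega>, bc_class (mat24 a z b)) (sort (map l [0..<m]))"
proof -
  note eig = eig_mult_pencil_basis[OF assms]
  have "count_list (sort (map l [0..<m])) x = eig_mult N (\<omega>, bc_class (mat24 a z b)) (of_real x)" for x
    unfolding eig count_list_eq_length_filter length_filter_sort_map
    by (intro arg_cong[of _ _ card]) auto
  then show ?thesis by (auto simp: eigenvalue_list_def eig)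
qed

text \<open>Set and multiplicities determine the multiset, and a sorted list is determined by its
  multiset. This justifies the definite description behind \<open>eigval\<close>.\<close>

lemma eigenvalue_list_unique:
  assumes "eigenvalue_list N p xs" "eigenvalue_list N p ys"
  shows "xs = ys"
proof -
  have set: "set xs = set ys"
  proof -
    have "complex_of_real ` set xs = of_real ` set ys"
      using assms unfolding eigenvalue_list_def by auto
    then show ?thesis by (simp add: inj_image_eq_iff inj_of_real)
  qed
  have "mset xs = mset ys"
  proof (rule multiset_eqI)
    fix x
    show "count (mset xs) x = count (mset ys) x"
    proof (cases "x \<in> set xs")
      case True
      then show ?thesis using assms set by (simp add: eigenvalue_list_def count_mset count_list_eq_length_filter)
    next
      case False
      then show ?thesis using set by (simp add: count_mset_0_iff[THEN iffD2])
    qed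
  qed
  then show ?thesis
    using assms by (metis eigenvalue_list_def properties_for_sort)
qed

section \<open>Counting eigenvalues by indices\<close>

definition spectrum :: "nat \<Rightarrow> sl_problem \<Rightarrow> real list" where
  "spectrum N p = (THE xs. eigenvalue_list N p xs)"

lemma spectrum_eqI: "eigenvalue_list N p xs \<Longrightarrow> spectrum N p = xs"
  unfolding spectrum_def by (rule the_equality) (auto intro: eigenvalue_list_unique)

lemma eigval_spectrum: "eigval N n p = spectrum N p ! n"
  by (simp add: eigval_def spectrum_def)

text \<open>The positions of entries below \<open>\<alpha>\<close> form an initial segment. This
  turns an estimate of one eigenvalue into a count, the form in which the indices provide
  information.\<close>

lemma sorted_nth_less_iff:
  fixes xs :: "real list"
  assumes "sorted xs" "n < length xs"
  shows "xs ! n < \<alpha> \<longleftrightarrow> n < length (filter (\<lambda>x. x < \<alpha>) xs)"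
proof -
  have card: "length (filter (\<lambda>x. x < \<alpha>) xs) = card {i. i < length xs \<and> xs ! i < \<alpha>}"
    by (rule length_filter_conv_card)
  show ?thesis
  proof
    assume *: "xs ! n < \<alpha>"
    have "{..n} \<subseteq> {i. i < length xs \<and> xs ! i < \<alpha>}"
    proof
      fix i assume "i \<in> {..n}"
      then show "i \<in> {i. i < length xs \<and> xs ! i < \<alpha>}"
        using sorted_nth_mono[OF assms(1), of i n] assms(2) * by simp
    qed
    then have "card {..n} \<le> card {i. i < length xs \<and> xs ! i < \<alpha>}" by (intro card_mono) auto
    then show "n < length (filter (\<lambda>x. x < \<alpha>) xs)" by (simp add: card)
  next
    assume *: "n < length (filter (\<lambda>x. x < \<alpha>) xs)"
    show "xs ! n < \<alpha>"
    proof (rule ccontr)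
      assume "\<not> xs ! n < \<alpha>"
      have "{i. i < length xs \<and> xs ! i < \<alpha>} \<subseteq> {..<n}"
      proof
        fix i assume "i \<in> {i. i < length xs \<and> xs ! i < \<alpha>}"
        then show "i \<in> {..<n}"
          using sorted_nth_mono[OF assms(1), of n i] \<open>\<not> xs ! n < \<alpha>\<close> by (cases "n \<le> i") auto
      qed
      then have "card {i. i < length xs \<and> xs ! i < \<alpha>} \<le> card {..<n}" by (intro card_mono) auto
      then show False using * by (simp add: card)
    qed
  qed
qed

lemma sorted_nth_greater_iff:
  fixes xs :: "real list"
  assumes "sorted xs" "n < length xs"
  shows "\<alpha> < xs ! n \<longleftrightarrow> length xs \<le> n + length (filter (\<lambda>x. \<alpha> < x) xs)"
proof -
  have card: "length (filter (\<lambda>x. \<alpha> < x) xs) = card {i. i < length xs \<and> \<alpha> < xs ! i}"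
    by (rule length_filter_conv_card)
  show ?thesis
  proof
    assume *: "\<alpha> < xs ! n"
    have "{n..<length xs} \<subseteq> {i. i < length xs \<and> \<alpha> < xs ! i}"
    proof
      fix i assume "i \<in> {n..<length xs}"
      then show "i \<in> {i. i < length xs \<and> \<alpha> < xs ! i}"
        using sorted_nth_mono[OF assms(1), of n i] * by simp
    qed
    then have "card {n..<length xs} \<le> card {i. i < length xs \<and> \<alpha> < xs ! i}" by (intro card_mono) auto
    then show "length xs \<le> n + length (filter (\<lambda>x. \<alpha> < x) xs)" by (simp add: card)
  next
    assume *: "length xs \<le> n + length (filter (\<lambda>x. \<alpha> < x) xs)"
    show "\<alpha> < xs ! n"
    proof (rule ccontr)
      assume "\<not> \<alpha> < xs ! n"
      have "{i. i < length xs \<and> \<alpha> < xs ! i} \<subseteq> {Suc n..<length xs}"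
      proof
        fix i assume "i \<in> {i. i < length xs \<and> \<alpha> < xs ! i}"
        then show "i \<in> {Suc n..<length xs}"
          using sorted_nth_mono[OF assms(1), of i n] assms(2) \<open>\<not> \<alpha> < xs ! n\<close>
          by (cases "i \<le> n") auto
      qed
      then have "card {i. i < length xs \<and> \<alpha> < xs ! i} \<le> card {Suc n..<length xs}"
        by (intro card_mono) auto
      then show False using * assms(2) by (simp add: card)
    qed
  qed
qed

definition count_below :: "nat \<Rightarrow> sl_problem \<Rightarrow> real \<Rightarrow> nat" where
  "count_below N p \<alpha> = length (filter (\<lambda>x. x < \<alpha>) (spectrum N p))"

definition count_above :: "nat \<Rightarrow> sl_problem \<Rightarrow> real \<Rightarrow> nat" where
  "count_above N p \<alpha> = length (filter (\<lambda>x. \<alpha> < x) (spectrum N p))"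

definition shifted_form ::
  "nat \<Rightarrow> sl_eqn \<Rightarrow> real \<Rightarrow> complex \<Rightarrow> real \<Rightarrow> real \<Rightarrow> (nat \<Rightarrow> complex) \<Rightarrow> (nat \<Rightarrow> complex) \<Rightarrow> complex" where
  "shifted_form N \<omega> a z b \<alpha> u v =
     energy_form N \<omega> a z b u v - of_real \<alpha> * wform N (coef_w \<omega>) u v"

lemma shifted_form_hermitian: "hermitian_form (shifted_form N \<omega> a z b \<alpha>)"
  unfolding shifted_form_def by (rule hermitian_form_pencil[OF energy_form_hermitian wform_hermitian])

context
  fixes N \<omega> a z b p
  assumes N: "2 \<le> N" and \<omega>: "\<omega> \<in> eqn_space N" and p: "p = (\<omega>, bc_class (mat24 a z b))"
begin

text \<open>The counts are expressed by one eigenbasis so that the index lemmas apply directly;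
  \<open>- l i < - \<alpha>\<close> is the shape that the negated pencil produces.\<close>

lemma spectrum_basis:
  obtains m e l where
    "pencil_basis N (energy_form N \<omega> a z b) (coef_w \<omega>) m e l"
    "eigenvalue_list N p (spectrum N p)"
    "length (spectrum N p) = (if a = - coef_f \<omega> 0 then N - 1 else N)"
    "\<And>\<alpha>. count_below N p \<alpha> = card {i. i < m \<and> l i < \<alpha>}"
    "\<And>\<alpha>. count_above N p \<alpha> = card {i. i < m \<and> - l i < - \<alpha>}"
proof -
  interpret pencil N "energy_form N \<omega> a z b" "coef_w \<omega>" "a + coef_f \<omega> 0"
    "\<lambda>n. - 1 / of_real (coef_f \<omega> 0) * unit_seq 1 n"
    by (rule energy_form_pencil[OF N \<omega>])
  obtain m e l where basis: "pencil_basis N (energy_form N \<omega> a z b) (coef_w \<omega>) m e l"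
    using pencil_basis_exists by blast
  have list: "eigenvalue_list N p (sort (map l [0..<m]))"
    unfolding p by (rule eigenvalue_list_pencil_basis[OF N \<omega> basis])
  then have sp: "spectrum N p = sort (map l [0..<m])" by (rule spectrum_eqI)
  have "a + coef_f \<omega> 0 = 0 \<longleftrightarrow> a = - coef_f \<omega> 0" by auto
  then have "length (spectrum N p) = (if a = - coef_f \<omega> 0 then N - 1 else N)"
    using basis_card[OF basis] by (simp add: sp)
  then show ?thesis
    using list by (intro that[OF basis])
      (simp_all add: sp count_below_def count_above_def length_filter_sort_map)
qed

lemma spectrum_list: "eigenvalue_list N p (spectrum N p)"
  and length_spectrum: "length (spectrum N p) = (if a = - coef_f \<omega> 0 then N - 1 else N)"
  by (rule spectrum_basis, assumption)+

lemma sorted_spectrum: "sorted (spectrum N p)"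
  using spectrum_list by (simp add: eigenvalue_list_def)

lemma eigval_less_iff:
  "n < length (spectrum N p) \<Longrightarrow> eigval N n p < \<alpha> \<longleftrightarrow> n < count_below N p \<alpha>"
  unfolding eigval_spectrum count_below_def by (rule sorted_nth_less_iff[OF sorted_spectrum])

lemma eigval_greater_iff:
  "n < length (spectrum N p) \<Longrightarrow>
    \<alpha> < eigval N n p \<longleftrightarrow> length (spectrum N p) \<le> n + count_above N p \<alpha>"
  unfolding eigval_spectrum count_above_def by (rule sorted_nth_greater_iff[OF sorted_spectrum])

lemma below_index_bound:
  fixes b' :: "nat \<Rightarrow> nat \<Rightarrow> complex"
  assumes "\<And>x. (\<exists>i<k. x i \<noteq> 0) \<Longrightarrow>
    Re (shifted_form N \<omega> a z b \<alpha> (lincomb {..<k} x b') (lincomb {..<k} x b')) < 0"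
  shows "k \<le> count_below N p \<alpha> + of_bool (a \<le> - coef_f \<omega> 0)"
proof -
  have [simp]: "a + coef_f \<omega> 0 \<le> 0 \<longleftrightarrow> a \<le> - coef_f \<omega> 0" by auto
  obtain m e l where basis: "pencil_basis N (energy_form N \<omega> a z b) (coef_w \<omega>) m e l"
    and cnt: "\<And>\<alpha>. count_below N p \<alpha> = card {i. i < m \<and> l i < \<alpha>}"
    by (rule spectrum_basis) (rule that)
  show ?thesis
    using pencil.negative_family_bound[OF energy_form_pencil[OF N \<omega>] basis, of k b' \<alpha>]
      assms unfolding cnt shifted_form_def by simp
qed

lemma above_index_bound:
  fixes b' :: "nat \<Rightarrow> nat \<Rightarrow> complex"
  assumes "\<And>x. (\<exists>i<k. x i \<noteq> 0) \<Longrightarrow>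
    Re (- shifted_form N \<omega> a z b \<alpha> (lincomb {..<k} x b') (lincomb {..<k} x b')) < 0"
  shows "k \<le> count_above N p \<alpha> + of_bool (- coef_f \<omega> 0 \<le> a)"
proof -
  have [simp]: "- (a + coef_f \<omega> 0) \<le> 0 \<longleftrightarrow> - coef_f \<omega> 0 \<le> a" by auto
  obtain m e l where basis: "pencil_basis N (energy_form N \<omega> a z b) (coef_w \<omega>) m e l"
    and cnt: "\<And>\<alpha>. count_above N p \<alpha> = card {i. i < m \<and> - l i < - \<alpha>}"
    by (rule spectrum_basis) (rule that)
  have "k \<le> card {i. i < m \<and> - l i < - \<alpha>} + of_bool (- (a + coef_f \<omega> 0) \<le> 0)"
  proof (rule pencil.negative_family_bound[OF pencil_uminus[OF energy_form_pencil[OF N \<omega>]]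
        pencil_basis_uminus[OF basis]])
    fix x :: "nat \<Rightarrow> complex" assume "\<exists>i<k. x i \<noteq> 0"
    from assms[OF this] show "Re (- energy_form N \<omega> a z b (lincomb {..<k} x b') (lincomb {..<k} x b') -
       of_real (- \<alpha>) * wform N (coef_w \<omega>) (lincomb {..<k} x b') (lincomb {..<k} x b')) < 0"
      by (simp add: shifted_form_def)
  qed
  then show ?thesis unfolding cnt by (simp only: \<open>- (a + coef_f \<omega> 0) \<le> 0 \<longleftrightarrow> - coef_f \<omega> 0 \<le> a\<close>)
qed

lemma below_index_family:
  obtains b' :: "nat \<Rightarrow> nat \<Rightarrow> complex" where
    "\<And>i. i < count_below N p \<alpha> + of_bool (a \<le> - coef_f \<omega> 0) \<Longrightarrow>
      Re (shifted_form N \<omega> a z b \<alpha> (b' i) (b' i)) < 0"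
    "\<And>i j. i < count_below N p \<alpha> + of_bool (a \<le> - coef_f \<omega> 0) \<Longrightarrow>
      j < count_below N p \<alpha> + of_bool (a \<le> - coef_f \<omega> 0) \<Longrightarrow> i \<noteq> j \<Longrightarrow>
      shifted_form N \<omega> a z b \<alpha> (b' i) (b' j) = 0"
proof -
  have iff: "a + coef_f \<omega> 0 \<le> 0 \<longleftrightarrow> a \<le> - coef_f \<omega> 0" by auto
  obtain m e l where basis: "pencil_basis N (energy_form N \<omega> a z b) (coef_w \<omega>) m e l"
    and cnt: "\<And>\<alpha>. count_below N p \<alpha> = card {i. i < m \<and> l i < \<alpha>}"
    by (rule spectrum_basis) (rule that)
  show ?thesis
    using pencil.negative_family_exists[OF energy_form_pencil[OF N \<omega>] basis, of \<alpha>, folded cnt, unfolded iff]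
    by (elim exE) (rule that, auto simp: shifted_form_def)
qed

lemma above_index_family:
  obtains b' :: "nat \<Rightarrow> nat \<Rightarrow> complex" where
    "\<And>i. i < count_above N p \<alpha> + of_bool (- coef_f \<omega> 0 \<le> a) \<Longrightarrow>
      Re (- shifted_form N \<omega> a z b \<alpha> (b' i) (b' i)) < 0"
    "\<And>i j. i < count_above N p \<alpha> + of_bool (- coef_f \<omega> 0 \<le> a) \<Longrightarrow>
      j < count_above N p \<alpha> + of_bool (- coef_f \<omega> 0 \<le> a) \<Longrightarrow> i \<noteq> j \<Longrightarrow>
      - shifted_form N \<omega> a z b \<alpha> (b' i) (b' j) = 0"
proof -
  have iff: "- (a + coef_f \<omega> 0) \<le> 0 \<longleftrightarrow> - coef_f \<omega> 0 \<le> a" by auto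
  obtain m e l where basis: "pencil_basis N (energy_form N \<omega> a z b) (coef_w \<omega>) m e l"
    and cnt: "\<And>\<alpha>. count_above N p \<alpha> = card {i. i < m \<and> - l i < - \<alpha>}"
    by (rule spectrum_basis) (rule that)
  show ?thesis
    using pencil.negative_family_exists[OF pencil_uminus[OF energy_form_pencil[OF N \<omega>]]
        pencil_basis_uminus[OF basis], of "- \<alpha>", folded cnt, unfolded iff]
    by (elim exE) (rule that, auto simp: shifted_form_def)
qed

end

section \<open>Coordinates on the space of problems\<close>

definition minor :: "bc_matrix \<Rightarrow> 4 \<Rightarrow> 4 \<Rightarrow> complex" where
  "minor M i j = M $ 1 $ i * M $ 2 $ j - M $ 1 $ j * M $ 2 $ i"

lemma minor_mult: "minor (T ** M) i j = det T * minor M i j"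
  by (simp add: minor_def det_2 matrix_matrix_mult_def sum_2 algebra_simps)

lemma continuous_on_minor [continuous_intros]: "continuous_on S (\<lambda>M. minor M i j)"
  unfolding minor_def by (intro continuous_intros)

text \<open>Pluecker coordinates of a class, normalized by the minor of the columns 2 and 4, which is
  nonzero on the coordinate set; they do not depend on the representative.\<close>

definition plucker_ratio :: "4 \<Rightarrow> 4 \<Rightarrow> bc_matrix set \<Rightarrow> complex" where
  "plucker_ratio i j c = minor (SOME M. M \<in> c) i j / minor (SOME M. M \<in> c) 2 4"

lemma bc_classE:
  assumes "M' \<in> bc_class M"
  obtains T where "M' = T ** M" "det T \<noteq> 0"
  using assms by (auto simp: bc_class_def invertible_det_nz)

lemma plucker_ratio_class: "plucker_ratio i j (bc_class M) = minor M i j / minor M 2 4"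
proof -
  have "(SOME M'. M' \<in> bc_class M) \<in> bc_class M"
    using bc_class_refl by (rule someI)
  then obtain T where "(SOME M'. M' \<in> bc_class M) = T ** M" "det T \<noteq> 0"
    by (rule bc_classE)
  then show ?thesis by (simp add: plucker_ratio_def minor_mult)
qed

text \<open>The matrices with nonzero minor 2 4 form an open set that is a union of classes, so the
  class map restricted to it is again a quotient map. Continuity can then be checked on matrices,
  where the ratio is a quotient of polynomials.\<close>

lemma continuous_map_plucker_ratio:
  "continuous_map (subtopology bc_quotient_topology (bc_class ` {M \<in> rank2_matrices. minor M 2 4 \<noteq> 0}))
     euclidean (plucker_ratio i j)"
proof -
  define U where "U = {M \<in> rank2_matrices. minor M 2 4 \<noteq> 0}"
  define V where "V = bc_class ` U"
  have pre: "{M \<in> rank2_matrices. bc_class M \<in> V} = U"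
  proof -
    have "minor M 2 4 \<noteq> 0" if "bc_class M = bc_class M'" "minor M' 2 4 \<noteq> 0" for M M'
    proof -
      have "M \<in> bc_class M'" using bc_class_refl[of M] that(1) by simp
      then obtain T where "M = T ** M'" "det T \<noteq> 0" by (rule bc_classE)
      then show ?thesis using that(2) by (simp add: minor_mult)
    qed
    then show ?thesis by (auto simp: V_def U_def)
  qed
  have "open {M. minor M 2 4 \<noteq> 0}"
    by (intro open_Collect_neq continuous_intros)
  then have "openin (top_of_set rank2_matrices) U"
    unfolding openin_open U_def by blast
  then have V: "openin bc_quotient_topology V"
    unfolding openin_bc_quotient_topology pre by (auto simp: V_def U_def)
  have quot: "quotient_map (subtopology (top_of_set rank2_matrices) U)
      (subtopology bc_quotient_topology V) bc_class"
    by (rule quotient_map_restriction[OF quotient_map_bc_class]) (use pre V in auto)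
  have "continuous_on (rank2_matrices \<inter> U) (plucker_ratio i j \<circ> bc_class)"
    unfolding o_def plucker_ratio_class
    by (intro continuous_intros) (auto simp: U_def)
  then have "continuous_map (subtopology (top_of_set rank2_matrices) U) euclidean
      (plucker_ratio i j \<circ> bc_class)"
    by (simp add: subtopology_subtopology)
  from continuous_compose_quotient_map[OF quot this] show ?thesis
    by (simp only: V_def U_def)
qed

lemma mat24_components:
  "mat24 a z b $ 1 $ 1 = of_real a" "mat24 a z b $ 1 $ 2 = - 1" "mat24 a z b $ 1 $ 3 = cnj z"
  "mat24 a z b $ 1 $ 4 = 0" "mat24 a z b $ 2 $ 1 = z" "mat24 a z b $ 2 $ 2 = 0"
  "mat24 a z b $ 2 $ 3 = of_real b" "mat24 a z b $ 2 $ 4 = 1"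
  by (simp_all add: mat24_def)

lemma minor_mat24:
  "minor (mat24 a z b) 2 4 = - 1" "minor (mat24 a z b) 1 4 = of_real a"
  "minor (mat24 a z b) 1 2 = z" "minor (mat24 a z b) 2 3 = - of_real b"
  by (simp_all add: minor_def mat24_components)

lemma mat24_rank2: "mat24 a z b \<in> rank2_matrices"
proof -
  let ?r = "\<lambda>i. row i (mat24 a z b)"
  have "rows (mat24 a z b) = {?r 1, ?r 2}"
    unfolding rows_def using exhaust_2 by (auto; metis)
  moreover have neq: "?r 1 \<notin> vec.span {?r 2}"
  proof
    assume "?r 1 \<in> vec.span {?r 2}"
    then obtain k where "?r 1 = k *s ?r 2" by (auto simp: vec.span_singleton)
    then have "?r 1 $ 2 = (k *s ?r 2) $ 2" by simp
    then show False by (simp add: row_def mat24_components)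
  qed
  moreover have "?r 2 \<noteq> 0"
  proof
    assume "?r 2 = 0"
    then have "?r 2 $ 4 = 0" by simp
    then show False by (simp add: row_def mat24_components)
  qed
  moreover have "?r 1 \<noteq> ?r 2" using neq vec.span_base[of "?r 2" "{?r 2}"] by auto
  ultimately have "vec.dim (rows (mat24 a z b)) = 2"
    by (simp add: vec.dim_eq_card_independent vec.independent_insert)
  then show ?thesis by (simp add: rank2_matrices_def row_rank_def_gen)
qed

lemma mat24_bc_space: "bc_class (mat24 a z b) \<in> bc_space"
proof -
  have "block_A (mat24 a z b) ** J_mat ** conj_transpose (block_A (mat24 a z b)) =
      block_B (mat24 a z b) ** J_mat ** conj_transpose (block_B (mat24 a z b))"
    by (simp add: vec_eq_iff forall_2 matrix_matrix_mult_def sum_2 block_A_def block_B_def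
        conj_transpose_def J_mat_def mat24_components)
  then show ?thesis unfolding bc_space_def using mat24_rank2 by blast
qed

text \<open>In this and the next two coordinates the signs compensate for the normalizing minor,
  which is \<open>- 1\<close> on \<open>mat24 a z b\<close>, while the minors 1 4, 1 2 and 2 3 are
  \<open>a\<close>, \<open>z\<close> and \<open>- b\<close>.\<close>

definition bc_a :: "sl_problem \<Rightarrow> real" where
  "bc_a p = - Re (plucker_ratio 1 4 (snd p))"

definition bc_z :: "sl_problem \<Rightarrow> complex" where
  "bc_z p = - plucker_ratio 1 2 (snd p)"

definition bc_b :: "sl_problem \<Rightarrow> real" where
  "bc_b p = Re (plucker_ratio 2 3 (snd p))"

lemma bc_coordinates [simp]:
  "bc_a (\<omega>, bc_class (mat24 a z b)) = a"
  "bc_z (\<omega>, bc_class (mat24 a z b)) = z"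
  "bc_b (\<omega>, bc_class (mat24 a z b)) = b"
  by (simp_all add: bc_a_def bc_z_def bc_b_def plucker_ratio_class minor_mat24)

abbreviation chart :: "nat \<Rightarrow> sl_problem set" where
  "chart N \<equiv> eqn_space N \<times> O24"

abbreviation f0 :: "sl_problem \<Rightarrow> real" where
  "f0 p \<equiv> coef_f (fst p) 0"

lemma chart_problem:
  assumes "p \<in> chart N"
  shows "fst p \<in> eqn_space N" "p = (fst p, bc_class (mat24 (bc_a p) (bc_z p) (bc_b p)))"
  using assms by (auto simp: O24_def)

lemma P24_chart:
  "P24 N = {p \<in> chart N. bc_a p = - f0 p}"
  "P24_plus N = {p \<in> chart N. bc_a p > - f0 p}"
  "P24_minus N = {p \<in> chart N. bc_a p < - f0 p}"
  by (auto simp: P24_def P24_plus_def P24_minus_def O24_def; blast)+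

section \<open>Continuity of the coordinates in the product topology\<close>

lemma topspace_eqn_topology: "topspace (eqn_topology N) = eqn_space N"
  by (auto simp: eqn_topology_def eqn_space_def)

lemma topspace_problem_topology: "topspace (problem_topology N) = problem_space N"
proof -
  have "bc_space \<subseteq> bc_class ` rank2_matrices" by (auto simp: bc_space_def)
  then show ?thesis
    by (auto simp: problem_topology_def topspace_eqn_topology bc_topology_def
        topspace_bc_quotient_topology problem_space_def)
qed

lemma chart_subset: "chart N \<subseteq> problem_space N"
  using mat24_bc_space by (auto simp: O24_def problem_space_def)

lemma chart_topology:
  "subtopology (problem_topology N) (chart N) =
    prod_topology (eqn_topology N) (subtopology bc_topology O24)"
  unfolding problem_topology_def subtopology_Times
  by (metis subtopology_topspace topspace_eqn_topology)

lemma continuous_map_chart_bc: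
  "continuous_map (subtopology (problem_topology N) (chart N)) euclidean (\<lambda>p. plucker_ratio i j (snd p))"
proof -
  have "O24 \<subseteq> bc_class ` {M \<in> rank2_matrices. minor M 2 4 \<noteq> 0}"
    by (auto simp: O24_def mat24_rank2 minor_mat24)
  then have "bc_space \<inter> O24 \<subseteq> bc_class ` {M \<in> rank2_matrices. minor M 2 4 \<noteq> 0}" by blast
  then have "continuous_map (subtopology bc_topology O24) euclidean (plucker_ratio i j)"
    unfolding bc_topology_def subtopology_subtopology
    by (rule continuous_map_from_subtopology_mono[OF continuous_map_plucker_ratio])
  then have "continuous_map (subtopology (problem_topology N) (chart N)) euclidean
      (plucker_ratio i j \<circ> snd)"
    unfolding chart_topology by (rule continuous_map_compose[OF continuous_map_snd])
  then show ?thesis by (simp add: o_def)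
qed

lemma continuous_map_chart_eqn:
  "n \<le> N \<Longrightarrow> continuous_map (subtopology (problem_topology N) (chart N)) euclideanreal
      (\<lambda>p. fst (fst p) n)"
  "n \<in> {1..N} \<Longrightarrow> continuous_map (subtopology (problem_topology N) (chart N)) euclideanreal
      (\<lambda>p. coef_q (fst p) n)"
  "n \<in> {1..N} \<Longrightarrow> continuous_map (subtopology (problem_topology N) (chart N)) euclideanreal
      (\<lambda>p. coef_w (fst p) n)"
proof -
  let ?X = "prod_topology (powertop_real {0..N}) (prod_topology (powertop_real {1..N}) (powertop_real {1..N}))"
  have lift: "continuous_map (subtopology (problem_topology N) (chart N)) euclideanreal (\<lambda>p. h (fst p))"
    if "continuous_map ?X euclideanreal h" for h
  proof -
    have "continuous_map (eqn_topology N) euclideanreal h"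
      unfolding eqn_topology_def by (rule continuous_map_from_subtopology[OF that])
    from continuous_map_compose[OF continuous_map_fst this] show ?thesis
      unfolding chart_topology by (simp add: o_def)
  qed
  show "continuous_map (subtopology (problem_topology N) (chart N)) euclideanreal (\<lambda>p. fst (fst p) n)"
    if "n \<le> N"
  proof (rule lift)
    show "continuous_map ?X euclideanreal (\<lambda>\<omega>. fst \<omega> n)"
      using continuous_map_compose[OF continuous_map_fst continuous_map_product_projection[of n "{0..N}"]]
        that by (force simp: o_def)
  qed
  show "continuous_map (subtopology (problem_topology N) (chart N)) euclideanreal (\<lambda>p. coef_q (fst p) n)"
    if "n \<in> {1..N}"
  proof (rule lift)
    show "continuous_map ?X euclideanreal (\<lambda>\<omega>. coef_q \<omega> n)"
      using continuous_map_compose[OF continuous_map_compose[OF continuous_map_snd continuous_map_fst]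
          continuous_map_product_projection[of n "{1..N}"]] that
      by (force simp: o_def coef_q_def)
  qed
  show "continuous_map (subtopology (problem_topology N) (chart N)) euclideanreal (\<lambda>p. coef_w (fst p) n)"
    if "n \<in> {1..N}"
  proof (rule lift)
    show "continuous_map ?X euclideanreal (\<lambda>\<omega>. coef_w \<omega> n)"
      using continuous_map_compose[OF continuous_map_compose[OF continuous_map_snd continuous_map_snd]
          continuous_map_product_projection[of n "{1..N}"]] that
      by (force simp: o_def coef_w_def)
  qed
qed

abbreviation near :: "nat \<Rightarrow> sl_problem \<Rightarrow> sl_problem set \<Rightarrow> sl_problem filter" where
  "near N p S \<equiv> atin_within (problem_topology N) p S"

lemma tendsto_near_chart:
  assumes "continuous_map (subtopology (problem_topology N) (chart N)) euclidean h" "p \<in> chart N"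
  shows "(h \<longlongrightarrow> h p) (near N p (chart N))"
proof -
  have "p \<in> topspace (problem_topology N)"
    using assms(2) chart_subset by (auto simp: topspace_problem_topology)
  then have "limitin euclidean h (h p) (near N p (chart N))"
    using limit_continuous_map_within[OF assms(1,2)] by blast
  then show ?thesis by simp
qed

lemma eventually_near_mono:
  "eventually P (near N p S) \<Longrightarrow> T \<subseteq> S \<Longrightarrow> eventually P (near N p T)"
  unfolding eventually_atin_within by blast

lemma eventually_near_in: "eventually (\<lambda>p'. p' \<in> S) (near N p S)"
  unfolding eventually_atin_within by (metis openin_topspace)

context
  fixes N p assumes p: "p \<in> chart N"
begin

lemma tendsto_coefs:
  "n \<le> N \<Longrightarrow> ((\<lambda>p. coef_f (fst p) n) \<longlongrightarrow> coef_f (fst p) n) (near N p (chart N))"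
  "n \<in> {1..N} \<Longrightarrow> ((\<lambda>p. coef_q (fst p) n) \<longlongrightarrow> coef_q (fst p) n) (near N p (chart N))"
  "n \<in> {1..N} \<Longrightarrow> ((\<lambda>p. coef_w (fst p) n) \<longlongrightarrow> coef_w (fst p) n) (near N p (chart N))"
  "(bc_a \<longlongrightarrow> bc_a p) (near N p (chart N))"
  "(bc_z \<longlongrightarrow> bc_z p) (near N p (chart N))"
  "(bc_b \<longlongrightarrow> bc_b p) (near N p (chart N))"
proof -
  show "((\<lambda>p. coef_f (fst p) n) \<longlongrightarrow> coef_f (fst p) n) (near N p (chart N))" if n: "n \<le> N"
  proof -
    \<comment> \<open>The stored component is the reciprocal of \<open>f\<close> and does not
      vanish, so inverting it is continuous.\<close>
    have "fst (fst p) n \<noteq> 0" using p n by (auto simp: eqn_space_def)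
    then show ?thesis unfolding coef_f_def
      by (intro tendsto_intros tendsto_near_chart[OF continuous_map_chart_eqn(1)[OF n] p])
  qed
  show "n \<in> {1..N} \<Longrightarrow> ((\<lambda>p. coef_q (fst p) n) \<longlongrightarrow> coef_q (fst p) n) (near N p (chart N))"
    "n \<in> {1..N} \<Longrightarrow> ((\<lambda>p. coef_w (fst p) n) \<longlongrightarrow> coef_w (fst p) n) (near N p (chart N))"
    using tendsto_near_chart[OF continuous_map_chart_eqn(2) p]
      tendsto_near_chart[OF continuous_map_chart_eqn(3) p] by blast+
  show "(bc_a \<longlongrightarrow> bc_a p) (near N p (chart N))" "(bc_z \<longlongrightarrow> bc_z p) (near N p (chart N))"
    "(bc_b \<longlongrightarrow> bc_b p) (near N p (chart N))"
    unfolding bc_a_def[abs_def] bc_z_def[abs_def] bc_b_def[abs_def]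
    by (intro tendsto_intros tendsto_near_chart[OF continuous_map_chart_bc p])+
qed

lemma tendsto_shifted_form:
  "((\<lambda>p. shifted_form N (fst p) (bc_a p) (bc_z p) (bc_b p) \<alpha> u v) \<longlongrightarrow>
     shifted_form N (fst p) (bc_a p) (bc_z p) (bc_b p) \<alpha> u v) (near N p (chart N))"
  unfolding shifted_form_def energy_form_def wform_def
  by (intro tendsto_intros tendsto_coefs) auto

end

section \<open>Limits of the eigenvalues\<close>

text \<open>A family that realizes the index at \<open>p\<close> stays negative definite nearby and
  bounds the index at \<open>p'\<close> from below. The two corrections remain visible because
  \<open>p\<close> and \<open>p'\<close> may lie on different sides of \<open>P24\<close>.\<close>

lemma count_below_lower_semicontinuous:
  assumes N: "2 \<le> N" and p: "p \<in> chart N"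
  shows "\<forall>\<^sub>F p' in near N p (chart N).
    count_below N p \<alpha> + of_bool (bc_a p \<le> - f0 p) \<le> count_below N p' \<alpha> + of_bool (bc_a p' \<le> - f0 p')"
proof -
  let ?F = "\<lambda>p. shifted_form N (fst p) (bc_a p) (bc_z p) (bc_b p) \<alpha>"
  let ?k = "count_below N p \<alpha> + of_bool (bc_a p \<le> - f0 p)"
  obtain b where b: "\<And>i. i < ?k \<Longrightarrow> Re (?F p (b i) (b i)) < 0"
    "\<And>i j. i < ?k \<Longrightarrow> j < ?k \<Longrightarrow> i \<noteq> j \<Longrightarrow> ?F p (b i) (b j) = 0"
    using below_index_family[OF N chart_problem[OF p]] by blast
  have "\<forall>\<^sub>F p' in near N p (chart N). \<forall>x. (\<exists>i<?k. x i \<noteq> 0) \<longrightarrow>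
      Re (?F p' (lincomb {..<?k} x b) (lincomb {..<?k} x b)) < 0"
    by (rule eventually_negative_definite[OF shifted_form_hermitian b tendsto_shifted_form[OF p]])
  with eventually_near_in show ?thesis
    by eventually_elim (use below_index_bound[OF N chart_problem] in blast)
qed

lemma count_above_lower_semicontinuous:
  assumes N: "2 \<le> N" and p: "p \<in> chart N"
  shows "\<forall>\<^sub>F p' in near N p (chart N).
    count_above N p \<alpha> + of_bool (- f0 p \<le> bc_a p) \<le> count_above N p' \<alpha> + of_bool (- f0 p' \<le> bc_a p')"
proof -
  let ?F = "\<lambda>p u v. - shifted_form N (fst p) (bc_a p) (bc_z p) (bc_b p) \<alpha> u v"
  let ?k = "count_above N p \<alpha> + of_bool (- f0 p \<le> bc_a p)"
  have herm: "hermitian_form (?F p')" for p'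
    by (rule hermitian_form_uminus[OF shifted_form_hermitian])
  obtain b where b: "\<And>i. i < ?k \<Longrightarrow> Re (?F p (b i) (b i)) < 0"
    "\<And>i j. i < ?k \<Longrightarrow> j < ?k \<Longrightarrow> i \<noteq> j \<Longrightarrow> ?F p (b i) (b j) = 0"
    using above_index_family[OF N chart_problem[OF p]] by blast
  have "\<forall>\<^sub>F p' in near N p (chart N). \<forall>x. (\<exists>i<?k. x i \<noteq> 0) \<longrightarrow>
      Re (?F p' (lincomb {..<?k} x b) (lincomb {..<?k} x b)) < 0"
    by (rule eventually_negative_definite[OF herm b tendsto_minus[OF tendsto_shifted_form[OF p]]])
  with eventually_near_in show ?thesis
    by eventually_elim (use above_index_bound[OF N chart_problem] in blast)
qed

lemma length_spectrum_chart:
  "2 \<le> N \<Longrightarrow> p \<in> chart N \<Longrightarrow> length (spectrum N p) = (if bc_a p = - f0 p then N - 1 else N)"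
  using length_spectrum[OF _ chart_problem] by blast

lemma has_exactly_eigenvalues_iff:
  assumes "2 \<le> N" "p \<in> chart N"
  shows "has_exactly_eigenvalues N p k \<longleftrightarrow> k = length (spectrum N p)"
  using spectrum_list[OF assms(1) chart_problem[OF assms(2)]] eigenvalue_list_unique
  unfolding has_exactly_eigenvalues_def by blast

text \<open>The last hypothesis equates positions in the negative index, where \<open>of_bool (bc_a p \<le> - f0 p)\<close>
  is the contribution of the coordinate \<open>0\<close>.\<close>

lemma tendsto_eigval:
  assumes N: "2 \<le> N" and p: "p \<in> chart N" and S: "S \<subseteq> chart N"
    and k: "k < length (spectrum N p)"
    and shift: "\<forall>\<^sub>F p' in near N p S. n < length (spectrum N p') \<and>
      n + of_bool (bc_a p' \<le> - f0 p') = k + of_bool (bc_a p \<le> - f0 p)"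
  shows "(eigval N n \<longlongrightarrow> eigval N k p) (near N p S)"
proof (rule order_tendstoI)
  fix \<alpha> assume "\<alpha> < eigval N k p"
  then have above: "length (spectrum N p) \<le> k + count_above N p \<alpha>"
    using eigval_greater_iff[OF N chart_problem[OF p] k] by blast
  from eventually_near_mono[OF count_above_lower_semicontinuous[OF N p, of \<alpha>] S] eventually_near_in shift
  show "\<forall>\<^sub>F p' in near N p S. \<alpha> < eigval N n p'"
  proof eventually_elim
    case (elim p')
    then have p': "p' \<in> chart N" using S by blast
    \<comment> \<open>The length of the spectrum plus both corrections is \<open>N + 1\<close> at
      \<open>p\<close> and at \<open>p'\<close>. Hence matching positions in the negative index also
      match in the positive index, counted from the top.\<close>
    have "length (spectrum N p') \<le> n + count_above N p' \<alpha>"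
      using elim above N length_spectrum_chart[OF N p] length_spectrum_chart[OF N p']
      by (cases "bc_a p" "- f0 p" rule: linorder_cases; cases "bc_a p'" "- f0 p'" rule: linorder_cases) auto
    then show ?case using elim eigval_greater_iff[OF N chart_problem[OF p']] by blast
  qed
next
  fix \<alpha> assume "eigval N k p < \<alpha>"
  then have below: "k < count_below N p \<alpha>"
    using eigval_less_iff[OF N chart_problem[OF p] k] by blast
  from eventually_near_mono[OF count_below_lower_semicontinuous[OF N p, of \<alpha>] S] eventually_near_in shift
  show "\<forall>\<^sub>F p' in near N p S. eigval N n p' < \<alpha>"
  proof eventually_elim
    case (elim p')
    then have p': "p' \<in> chart N" using S by blast
    have "n < count_below N p' \<alpha>" using elim below by linarith
    then show ?case using elim eigval_less_iff[OF N chart_problem[OF p']] by blast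
  qed
qed

lemma continuous_map_eigval:
  assumes "\<And>p. p \<in> S \<Longrightarrow> p \<in> problem_space N \<Longrightarrow> (eigval N n \<longlongrightarrow> eigval N n p) (near N p S)"
  shows "continuous_map (subtopology (problem_topology N) S) euclideanreal (eigval N n)"
  unfolding continuous_map_atin
  using assms by (auto simp: atin_subtopology_within topspace_problem_topology)

text \<open>Limits along the plus side contradict continuity only if they are not vacuous. Raising
  the entry \<open>a\<close> while keeping everything else gives a continuous path from
  \<open>p\<close> into \<open>P24_plus N\<close>.\<close>

lemma P24_plus_accumulates:
  assumes "p \<in> P24 N"
  shows "near N p (P24_plus N) \<noteq> bot"
proof
  assume bot: "near N p (P24_plus N) = bot"
  obtain \<omega> a z b where p: "p = (\<omega>, bc_class (mat24 a z b))" "\<omega> \<in> eqn_space N" "a = - coef_f \<omega> 0"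
    using assms by (auto simp: P24_def)
  define path where "path = (\<lambda>t. (\<omega>, bc_class (mat24 (a + t) z b)))"
  have cont: "continuous_map euclideanreal (problem_topology N) path"
    unfolding path_def problem_topology_def continuous_map_pairwise o_def fst_conv snd_conv
  proof
    show "continuous_map euclideanreal (eqn_topology N) (\<lambda>t. \<omega>)"
      using p(2) by (simp add: topspace_eqn_topology)
    define E :: bc_matrix where "E = (\<chi> i j. if i = 1 \<and> j = 1 then 1 else 0)"
    have "mat24 (a + t) z b = mat24 a z b + t *\<^sub>R E" for t
      by (simp add: vec_eq_iff forall_2 forall_4 mat24_components E_def)
        (simp add: of_real_def)
    then have "continuous_on UNIV (\<lambda>t. mat24 (a + t) z b)"
      by (simp add: continuous_intros)
    then have "continuous_map euclideanreal (top_of_set rank2_matrices) (\<lambda>t. mat24 (a + t) z b)"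
      by (simp add: continuous_map_in_subtopology mat24_rank2 image_subset_iff)
    from continuous_map_compose[OF this quotient_imp_continuous_map[OF quotient_map_bc_class]]
    show "continuous_map euclideanreal bc_topology (\<lambda>t. bc_class (mat24 (a + t) z b))"
      unfolding bc_topology_def
      by (simp add: continuous_map_in_subtopology o_def mat24_bc_space image_subset_iff)
  qed
  have "eventually (\<lambda>_. False) (near N p (P24_plus N))" unfolding bot by simp
  moreover have "p \<in> topspace (problem_topology N)"
    using assms chart_subset by (auto simp: topspace_problem_topology P24_chart)
  ultimately obtain T where T: "openin (problem_topology N) T" "p \<in> T"
    "\<And>p'. p' \<in> T \<Longrightarrow> p' \<in> P24_plus N \<Longrightarrow> p' = p"
    unfolding eventually_atin_within by blast
  have "open {t. path t \<in> T}"
    using openin_continuous_map_preimage[OF cont T(1)] by simp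
  moreover have "path 0 \<in> T" using T(2) by (simp add: path_def p(1))
  ultimately obtain r where r: "r > 0" "\<And>t. \<bar>t\<bar> < r \<Longrightarrow> path t \<in> T"
    unfolding open_dist by (auto simp: dist_real_def)
  have plus: "path (r / 2) \<in> P24_plus N"
    unfolding path_def P24_chart using p(2,3) r(1) by (auto simp: O24_def; blast)
  then have "path (r / 2) = p" using T(3) r by simp
  then show False using plus assms by (auto simp: P24_chart)
qed

lemma eigval_domain_chart:
  assumes "2 \<le> N" "p \<in> chart N"
  shows "p \<in> eigval_domain N n \<longleftrightarrow> n < length (spectrum N p)"
  using chart_subset assms(2) by (auto simp: eigval_domain_def has_exactly_eigenvalues_iff[OF assms])

theorem theorem5p2:
  fixes N :: nat
  assumes "N \<ge> 2"
  shows "(\<forall>p \<in> P24 N. has_exactly_eigenvalues N p (N - 1)) \<and>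
    (\<forall>p \<in> eqn_space N \<times> O24 - P24 N. has_exactly_eigenvalues N p N) \<and>
    (\<forall>n < N. continuous_map (subtopology (problem_topology N) (eqn_space N \<times> O24 - P24 N))
       euclideanreal (eigval N n)) \<and>
    (\<forall>p \<in> P24 N.
       (\<forall>n < N. \<not> (1 \<le> n \<and> n \<le> N - 2 \<and> eigval N (n - 1) p = eigval N n p) \<longrightarrow>
          \<not> eigval_continuous_at N n p) \<and>
       (\<forall>n \<le> N - 2.
          (eigval N n \<longlongrightarrow> eigval N n p)
            (atin_within (problem_topology N) p (P24_minus N \<union> P24 N))) \<and>
       filterlim (eigval N (N - 1)) at_top (atin_within (problem_topology N) p (P24_minus N)) \<and>
       filterlim (eigval N 0) at_bot (atin_within (problem_topology N) p (P24_plus N)) \<and>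
       (\<forall>n \<in> {1..N - 1}.
          (eigval N n \<longlongrightarrow> eigval N (n - 1) p)
            (atin_within (problem_topology N) p (P24_plus N)))) \<and>
    (\<forall>n \<le> N - 2. continuous_map (subtopology (problem_topology N) (P24_minus N \<union> P24 N))
       euclideanreal (eigval N n))"
proof (intro conjI ballI allI impI)
  note len = length_spectrum_chart[OF assms]
  have minus_chart: "P24_minus N \<union> P24 N \<subseteq> chart N" "P24_plus N \<subseteq> chart N" "P24_minus N \<subseteq> chart N"
    by (auto simp: P24_chart)
  \<comment> \<open>At \<open>p\<close> coordinate \<open>0\<close> occupies one place in the
    negative index, at points of \<open>P24_plus N\<close> none, so position \<open>n\<close> there
    corresponds to position \<open>n - 1\<close> at \<open>p\<close>.\<close>
  have plus_limit: "(eigval N n \<longlongrightarrow> eigval N (n - 1) p) (near N p (P24_plus N))"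
    if "p \<in> P24 N" "n \<in> {1..N - 1}" for p n
  proof (rule tendsto_eigval[OF assms _ minus_chart(2)])
    show "\<forall>\<^sub>F p' in near N p (P24_plus N). n < length (spectrum N p') \<and>
      n + of_bool (bc_a p' \<le> - f0 p') = n - 1 + of_bool (bc_a p \<le> - f0 p)"
      using eventually_near_in by eventually_elim (use that len in \<open>auto simp: P24_chart\<close>)
  qed (use that len in \<open>auto simp: P24_chart\<close>)
  have plus_bot: "filterlim (eigval N 0) at_bot (near N p (P24_plus N))" if "p \<in> P24 N" for p
    unfolding filterlim_at_bot_dense
  proof
    fix \<alpha>
    have p: "p \<in> chart N" using that by (simp add: P24_chart)
    from eventually_near_mono[OF count_below_lower_semicontinuous[OF assms p, of \<alpha>] minus_chart(2)]
      eventually_near_in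
    show "\<forall>\<^sub>F p' in near N p (P24_plus N). eigval N 0 p' < \<alpha>"
    proof eventually_elim
      case (elim p')
      then have p': "p' \<in> chart N" "bc_a p' > - f0 p'" by (auto simp: P24_chart)
      \<comment> \<open>For every \<open>\<alpha>\<close> the negative index at \<open>p\<close> is
        at least 1 because of coordinate \<open>0\<close>. At \<open>p'\<close> this coordinate no
        longer counts, so an eigenvalue below \<open>\<alpha>\<close> has to account for it.\<close>
      then have "0 < count_below N p' \<alpha>" using elim that by (simp add: P24_chart)
      then show ?case
        using eigval_less_iff[OF assms chart_problem[OF p'(1)], of 0] len[OF p'(1)] p'(2) assms by simp
    qed
  qed
  {
    fix p assume "p \<in> P24 N"
    then show "has_exactly_eigenvalues N p (N - 1)"
      using len by (subst has_exactly_eigenvalues_iff[OF assms]) (auto simp: P24_chart)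
  next
    fix p assume "p \<in> chart N - P24 N"
    then show "has_exactly_eigenvalues N p N"
      using len by (subst has_exactly_eigenvalues_iff[OF assms]) (auto simp: P24_chart)
  next
    fix n assume n: "n < N"
    show "continuous_map (subtopology (problem_topology N) (chart N - P24 N)) euclideanreal (eigval N n)"
    proof (rule continuous_map_eigval)
      fix p assume p: "p \<in> chart N - P24 N"
      then have p': "p \<in> chart N" "bc_a p + f0 p \<noteq> 0" by (auto simp: P24_chart)
      have lim: "((\<lambda>p. bc_a p + f0 p) \<longlongrightarrow> bc_a p + f0 p) (near N p (chart N))"
        by (intro tendsto_add tendsto_coefs[OF p'(1)]) simp
      \<comment> \<open>Off \<open>P24\<close> the sign of \<open>a\<close> plus \<open>f\<close> at
        \<open>0\<close> is locally constant, so coordinate \<open>0\<close> keeps its place in the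
        index.\<close>
      have "\<forall>\<^sub>F p' in near N p (chart N). (bc_a p' + f0 p' \<le> 0) = (bc_a p + f0 p \<le> 0)"
      proof (cases "bc_a p + f0 p < 0")
        case True
        from order_tendstoD(2)[OF lim this] show ?thesis
          by eventually_elim (use True in simp)
      next
        case False
        then have "0 < bc_a p + f0 p" using p'(2) by simp
        from order_tendstoD(1)[OF lim this] show ?thesis
          by eventually_elim (use \<open>0 < bc_a p + f0 p\<close> in simp)
      qed
      then have sign: "\<forall>\<^sub>F p' in near N p (chart N - P24 N).
          (bc_a p' + f0 p' \<le> 0) = (bc_a p + f0 p \<le> 0)"
        by (rule eventually_near_mono) blast
      show "(eigval N n \<longlongrightarrow> eigval N n p) (near N p (chart N - P24 N))"
      proof (rule tendsto_eigval[OF assms p'(1)])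
        show "n < length (spectrum N p)" using n p len by (auto simp: P24_chart)
        show "\<forall>\<^sub>F p' in near N p (chart N - P24 N). n < length (spectrum N p') \<and>
          n + of_bool (bc_a p' \<le> - f0 p') = n + of_bool (bc_a p \<le> - f0 p)"
          using sign eventually_near_in
        proof eventually_elim
          case (elim q)
          have "(bc_a q \<le> - f0 q) = (bc_a p \<le> - f0 p)" using elim(1) by argo
          moreover have "n < length (spectrum N q)" using n elim(2) len by (auto simp: P24_chart)
          ultimately show ?case by simp
        qed
      qed blast
    qed
  next
    fix p n assume p: "p \<in> P24 N" and n: "n < N"
      and neq: "\<not> (1 \<le> n \<and> n \<le> N - 2 \<and> eigval N (n - 1) p = eigval N n p)"
    show "\<not> eigval_continuous_at N n p"
    proof
      assume cont: "eigval_continuous_at N n p"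
      have chart: "p \<in> chart N" using p by (simp add: P24_chart)
      have dom: "p \<in> eigval_domain N n"
        using cont by (simp add: eigval_continuous_at_def topcontinuous_at_def)
      \<comment> \<open>The eigenvalue with index \<open>N - 1\<close> is not defined at
        \<open>p\<close>, so the assumed continuity excludes it.\<close>
      then have n': "n < N - 1"
        using p eigval_domain_chart[OF assms chart] len[OF chart] by (simp add: P24_chart)
      have "limitin euclideanreal (eigval N n) (eigval N n p) (near N p (eigval_domain N n))"
        using cont unfolding eigval_continuous_at_def topcontinuous_at_atin atin_subtopology_within[OF dom]
        by blast
      \<comment> \<open>All \<open>N\<close> eigenvalues exist on the plus side, so the limit
        supplied by continuity is inherited there and can be compared with the known one.\<close>
      moreover have "P24_plus N \<subseteq> eigval_domain N n"
        using n eigval_domain_chart[OF assms] len by (auto simp: P24_chart)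
      ultimately have "limitin euclideanreal (eigval N n) (eigval N n p) (near N p (P24_plus N))"
        by (rule limit_within_subset)
      then have lim: "(eigval N n \<longlongrightarrow> eigval N n p) (near N p (P24_plus N))" by simp
      show False
      proof (cases "n = 0")
        case True
        have "\<forall>\<^sub>F p' in near N p (P24_plus N). eigval N 0 p' < eigval N 0 p - 1"
          using plus_bot[OF p] unfolding filterlim_at_bot_dense by blast
        moreover have "\<forall>\<^sub>F p' in near N p (P24_plus N). eigval N 0 p - 1 < eigval N 0 p'"
          by (rule order_tendstoD(1)[OF lim[unfolded True]]) simp
        ultimately have "\<forall>\<^sub>F p' in near N p (P24_plus N). False"
          by eventually_elim simp
        then show False using P24_plus_accumulates[OF p] by (simp add: trivial_limit_def)
      next
        case False
        then have "(eigval N n \<longlongrightarrow> eigval N (n - 1) p) (near N p (P24_plus N))"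
          using n by (intro plus_limit[OF p]) auto
        then have "eigval N n p = eigval N (n - 1) p"
          by (rule tendsto_unique[OF P24_plus_accumulates[OF p] lim])
        then show False using neq False n' by auto
      qed
    qed
  next
    fix p n assume p: "p \<in> P24 N" and n: "n \<le> N - 2"
    \<comment> \<open>Throughout \<open>P24_minus N \<union> P24 N\<close> coordinate
      \<open>0\<close> counts in the negative index, so positions agree without a shift;
      \<open>n \<le> N - 2\<close> keeps \<open>n\<close> within the shorter spectra on
      \<open>P24 N\<close>.\<close>
    show "(eigval N n \<longlongrightarrow> eigval N n p) (near N p (P24_minus N \<union> P24 N))"
    proof (rule tendsto_eigval[OF assms _ minus_chart(1)])
      show "\<forall>\<^sub>F p' in near N p (P24_minus N \<union> P24 N). n < length (spectrum N p') \<and>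
        n + of_bool (bc_a p' \<le> - f0 p') = n + of_bool (bc_a p \<le> - f0 p)"
        using eventually_near_in by eventually_elim (use p n assms len in \<open>auto simp: P24_chart\<close>)
    qed (use p n assms len in \<open>auto simp: P24_chart\<close>)
  next
    fix p assume p: "p \<in> P24 N"
    show "filterlim (eigval N (N - 1)) at_top (near N p (P24_minus N))"
      unfolding filterlim_at_top_dense
    proof
      fix \<alpha>
      have chart: "p \<in> chart N" using p by (simp add: P24_chart)
      from eventually_near_mono[OF count_above_lower_semicontinuous[OF assms chart, of \<alpha>] minus_chart(3)]
        eventually_near_in
      show "\<forall>\<^sub>F p' in near N p (P24_minus N). \<alpha> < eigval N (N - 1) p'"
      proof eventually_elim
        case (elim p')
        then have p': "p' \<in> chart N" "bc_a p' < - f0 p'" by (auto simp: P24_chart)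
        \<comment> \<open>Dually, coordinate \<open>0\<close> counts in the positive index at
          \<open>p\<close> but not at \<open>p'\<close>, where an eigenvalue above
          \<open>\<alpha>\<close> has to replace it.\<close>
        then have "0 < count_above N p' \<alpha>" using elim p by (simp add: P24_chart)
        then show ?case
          using eigval_greater_iff[OF assms chart_problem[OF p'(1)], of "N - 1"] len[OF p'(1)] p'(2) assms
          by simp
      qed
    qed
    show "filterlim (eigval N 0) at_bot (near N p (P24_plus N))" by (rule plus_bot[OF p])
    show "(eigval N n \<longlongrightarrow> eigval N (n - 1) p) (near N p (P24_plus N))" if "n \<in> {1..N - 1}" for n
      by (rule plus_limit[OF p that])
  next
    fix n assume n: "n \<le> N - 2"
    show "continuous_map (subtopology (problem_topology N) (P24_minus N \<union> P24 N)) euclideanreal (eigval N n)"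
    proof (rule continuous_map_eigval)
      fix p assume p: "p \<in> P24_minus N \<union> P24 N"
      show "(eigval N n \<longlongrightarrow> eigval N n p) (near N p (P24_minus N \<union> P24 N))"
      proof (rule tendsto_eigval[OF assms _ minus_chart(1)])
        show "\<forall>\<^sub>F p' in near N p (P24_minus N \<union> P24 N). n < length (spectrum N p') \<and>
          n + of_bool (bc_a p' \<le> - f0 p') = n + of_bool (bc_a p \<le> - f0 p)"
          using eventually_near_in by eventually_elim (use p n assms len in \<open>auto simp: P24_chart\<close>)
      qed (use p n assms len in \<open>auto simp: P24_chart\<close>)
    qed
  }
qed

end
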